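(* Let $\mathbb{E}$ be a regular category and suppose that any chain of reflexive relations in $\mathbb{E}$ admits a supremum (among the reflexive relations on the same object) which is stable under composition of reflexive relations. Then, for any pair $(R,S)$ of preorders (resp. equivalence relations) on an object $X$, we get $\Sigma((R,S))=R\vee S$ in $PrO\,\mathbb{E}$ (resp. in $Equ\,\mathbb{E}$), i.e. $\Sigma((R,S))$ is the supremum of $R$ and $S$ among the preorders (resp. the equivalence relations) on $X$. So, any regular epimorphism $f:X\to Y$ in $\mathbb{E}$ admits a cocartesian map (with respect to $(\;)_0$) above it with any domain $T$ on $X$ in $PrO\,\mathbb{E}$ (resp. in $Equ\,\mathbb{E}$). It is given by the composite $T\hookrightarrow\Sigma((R[f],T))\twoheadrightarrow f(\Sigma((R[f],T)))$.
   Context: A relation on $X$ is (a class up to isomorphism of) a subobject $R\rightarrowtail X\times X$, ordered by inclusion. In a regular category relations compose: $SR=S\circ R$ is the usual composite relation ($x(SR)z$ iff there is $y$ with $xRy$ and $ySz$), defined by a pullback followed by the regular epi–mono factorization. $R$ is reflexive if $\Delta_X\subset R$, symmetric if $R^{op}\subset R$, transitive if $R\circ R\subset R$; a preorder is a reflexive transitive relation, an equivalence relation is a symmetric preorder. For $f:X\to Y$ and a relation $S$ on $Y$, $f^{-1}(S)$ is the pullback of $S\rightarrowtail Y\times Y$ along $f\times f$, and $R[f]=f^{-1}(\Delta_Y)$. For a regular epimorphism $f$ and a relation $R$ on $X$, the direct image $f(R)$ is the image of $R\rightarrowtail X\times X\xrightarrow{f\times f}Y\times Y$. $Ref\,\mathbb{E}$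 is the category whose objects are pairs (object $X$, reflexive relation $R$ on $X$) and in which a morphism $R\to S$ above $f:X\to Y$ exists (and is unique) iff $R\subset f^{-1}(S)$; $(\;)_0$ sends $R$ to its ground object $X$. $PrO\,\mathbb{E}$ and $Equ\,\mathbb{E}$ are its full subcategories of preorders and of equivalence relations. Given a functor $U:\mathbb{C}\to\mathbb{D}$, a map $f:X\to Z$ of $\mathbb{C}$ is cocartesian with respect to $U$ when, for every $\phi:X\to W$ with $U(\phi)=U(f)$, there is a unique $\psi:Z\to W$ with $\psi f=\phi$ and $U(\psi)=1_{U(Z)}$. A chain of reflexive relations on $X$ is an increasing sequence $(R_i)_{i\in\mathbb{N}}$ of reflexive relations on $X$; $\Sigma_{i\in\mathbb{N}}R_i$ denotes its supremum in the ordered set of reflexive relations on $X$. These suprema are stable under composition of reflexive relations when $\Sigma_{i\in\mathbb{N}}(R_iT)=(\Sigma_{i\in\mathbb{N}}R_i)T$ for every such chain and every reflexive relation $T$ on $X$. For reflexive relations $R,S$ on $X$, $((R,S))$ is the chain $\Delta_X\subset R\subset RS\subset RSR\subset RSRS\subset\cdots$, with terms $(R,S)_n$ (alternating product of $n$ factors beginning with $R$, $(R,S)_0=\Delta_X$), and $\Sigma((R,S))=\Sigma_{n\in\mathbb{N}}(R,S)_n$. *)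

theory Defs
  imports "HOL-Algebra.Lattice"
begin

section \<open>Categories\<close>

record ('o, 'm) cat =
  Ob :: "'o set"
  Arr :: "'m set"
  Dom :: "'m \<Rightarrow> 'o"
  Cod :: "'m \<Rightarrow> 'o"
  Ident :: "'o \<Rightarrow> 'm"
  Comp :: "'m \<Rightarrow> 'm \<Rightarrow> 'm"  (infixr \<open>\<cdot>\<index>\<close> 70)

text \<open>\<open>g \<cdot>\<^bsub>C\<^esub> f\<close> is ``first \<open>f\<close>, then \<open>g\<close>''; it is only meaningful when \<open>Cod C f = Dom C g\<close>.\<close>

locale category =
  fixes C :: "('o, 'm) cat" (structure)
  assumes Dom_Ob: "f \<in> Arr C \<Longrightarrow> Dom C f \<in> Ob C"
    and Cod_Ob: "f \<in> Arr C \<Longrightarrow> Cod C f \<in> Ob C"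
    and Ident_Arr: "X \<in> Ob C \<Longrightarrow> Ident C X \<in> Arr C"
    and Dom_Ident: "X \<in> Ob C \<Longrightarrow> Dom C (Ident C X) = X"
    and Cod_Ident: "X \<in> Ob C \<Longrightarrow> Cod C (Ident C X) = X"
    and Comp_Arr: "f \<in> Arr C \<Longrightarrow> g \<in> Arr C \<Longrightarrow> Cod C f = Dom C g \<Longrightarrow> g \<cdot> f \<in> Arr C"
    and Dom_Comp: "f \<in> Arr C \<Longrightarrow> g \<in> Arr C \<Longrightarrow> Cod C f = Dom C g \<Longrightarrow> Dom C (g \<cdot> f) = Dom C f"
    and Cod_Comp: "f \<in> Arr C \<Longrightarrow> g \<in> Arr C \<Longrightarrow> Cod C f = Dom C g \<Longrightarrow> Cod C (g \<cdot> f) = Cod C g"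
    and Comp_Ident: "f \<in> Arr C \<Longrightarrow> f \<cdot> Ident C (Dom C f) = f"
    and Ident_Comp: "f \<in> Arr C \<Longrightarrow> Ident C (Cod C f) \<cdot> f = f"
    and Comp_assoc: "f \<in> Arr C \<Longrightarrow> g \<in> Arr C \<Longrightarrow> h \<in> Arr C \<Longrightarrow>
      Cod C f = Dom C g \<Longrightarrow> Cod C g = Dom C h \<Longrightarrow> (h \<cdot> g) \<cdot> f = h \<cdot> (g \<cdot> f)"

definition hom_set :: "('o, 'm) cat \<Rightarrow> 'o \<Rightarrow> 'o \<Rightarrow> 'm set" where
  "hom_set C X Y = {f \<in> Arr C. Dom C f = X \<and> Cod C f = Y}"

definition monic :: "('o, 'm) cat \<Rightarrow> 'm \<Rightarrow> bool" where
  "monic C m \<longleftrightarrow> m \<in> Arr C \<and>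
    (\<forall>u \<in> Arr C. \<forall>v \<in> Arr C. Dom C u = Dom C v \<and> Cod C u = Dom C m \<and> Cod C v = Dom C m \<and>
      m \<cdot>\<^bsub>C\<^esub> u = m \<cdot>\<^bsub>C\<^esub> v \<longrightarrow> u = v)"

definition isomorphism :: "('o, 'm) cat \<Rightarrow> 'm \<Rightarrow> bool" where
  "isomorphism C i \<longleftrightarrow> i \<in> Arr C \<and>
    (\<exists>j \<in> hom_set C (Cod C i) (Dom C i).
      j \<cdot>\<^bsub>C\<^esub> i = Ident C (Dom C i) \<and> i \<cdot>\<^bsub>C\<^esub> j = Ident C (Cod C i))"

definition is_terminal :: "('o, 'm) cat \<Rightarrow> 'o \<Rightarrow> bool" where
  "is_terminal C t \<longleftrightarrow> t \<in> Ob C \<and> (\<forall>X \<in> Ob C. \<exists>!h. h \<in> hom_set C X t)"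

definition is_product :: "('o, 'm) cat \<Rightarrow> 'o \<Rightarrow> 'o \<Rightarrow> 'm \<Rightarrow> 'm \<Rightarrow> bool" where
  "is_product C X Y p q \<longleftrightarrow> p \<in> Arr C \<and> q \<in> Arr C \<and> Dom C p = Dom C q \<and> Cod C p = X \<and> Cod C q = Y \<and>
    (\<forall>a \<in> Arr C. \<forall>b \<in> Arr C. Dom C a = Dom C b \<and> Cod C a = X \<and> Cod C b = Y \<longrightarrow>
      (\<exists>!h. h \<in> hom_set C (Dom C a) (Dom C p) \<and> p \<cdot>\<^bsub>C\<^esub> h = a \<and> q \<cdot>\<^bsub>C\<^esub> h = b))"

text \<open>\<open>is_pullback C f g p q\<close>: the square \<open>f p = g q\<close> is a pullback, \<open>p\<close> being the leg into the
  domain of \<open>f\<close> and \<open>q\<close> the leg into the domain of \<open>g\<close>. Thus \<open>is_pullback C f f p q\<close> says that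
  \<open>(p, q)\<close> is a kernel pair of \<open>f\<close>.\<close>

definition is_pullback :: "('o, 'm) cat \<Rightarrow> 'm \<Rightarrow> 'm \<Rightarrow> 'm \<Rightarrow> 'm \<Rightarrow> bool" where
  "is_pullback C f g p q \<longleftrightarrow>
    f \<in> Arr C \<and> g \<in> Arr C \<and> p \<in> Arr C \<and> q \<in> Arr C \<and> Cod C f = Cod C g \<and>
    Dom C p = Dom C q \<and> Cod C p = Dom C f \<and> Cod C q = Dom C g \<and> f \<cdot>\<^bsub>C\<^esub> p = g \<cdot>\<^bsub>C\<^esub> q \<and>
    (\<forall>a \<in> Arr C. \<forall>b \<in> Arr C.
      Dom C a = Dom C b \<and> Cod C a = Dom C f \<and> Cod C b = Dom C g \<and> f \<cdot>\<^bsub>C\<^esub> a = g \<cdot>\<^bsub>C\<^esub> b \<longrightarrow>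
      (\<exists>!h. h \<in> hom_set C (Dom C a) (Dom C p) \<and> p \<cdot>\<^bsub>C\<^esub> h = a \<and> q \<cdot>\<^bsub>C\<^esub> h = b))"

definition is_coequalizer :: "('o, 'm) cat \<Rightarrow> 'm \<Rightarrow> 'm \<Rightarrow> 'm \<Rightarrow> bool" where
  "is_coequalizer C u v e \<longleftrightarrow>
    u \<in> Arr C \<and> v \<in> Arr C \<and> e \<in> Arr C \<and> Dom C u = Dom C v \<and> Cod C u = Cod C v \<and>
    Dom C e = Cod C u \<and> e \<cdot>\<^bsub>C\<^esub> u = e \<cdot>\<^bsub>C\<^esub> v \<and>
    (\<forall>a \<in> Arr C. Dom C a = Cod C u \<and> a \<cdot>\<^bsub>C\<^esub> u = a \<cdot>\<^bsub>C\<^esub> v \<longrightarrow>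
      (\<exists>!h. h \<in> hom_set C (Cod C e) (Cod C a) \<and> h \<cdot>\<^bsub>C\<^esub> e = a))"

definition regular_epi :: "('o, 'm) cat \<Rightarrow> 'm \<Rightarrow> bool" where
  "regular_epi C e \<longleftrightarrow> (\<exists>u v. is_coequalizer C u v e)"

text \<open>Finite completeness is expressed by a terminal object and pullbacks.\<close>

locale regular_category = category +
  assumes ex_terminal: "\<exists>t. is_terminal C t"
    and ex_pullback: "f \<in> Arr C \<Longrightarrow> g \<in> Arr C \<Longrightarrow> Cod C f = Cod C g \<Longrightarrow> \<exists>p q. is_pullback C f g p q"
    and ex_coequalizer_kernel_pair: "is_pullback C f f p q \<Longrightarrow> \<exists>e. is_coequalizer C p q e"
    and regular_epi_stable: "is_pullback C f g p q \<Longrightarrow> regular_epi C f \<Longrightarrow> regular_epi C q"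


section \<open>Chosen binary products and subobjects\<close>

definition projs :: "('o, 'm) cat \<Rightarrow> 'o \<Rightarrow> 'o \<Rightarrow> 'm \<times> 'm" where
  "projs C X Y = (SOME pq. is_product C X Y (fst pq) (snd pq))"

definition pr1 :: "('o, 'm) cat \<Rightarrow> 'o \<Rightarrow> 'o \<Rightarrow> 'm" where
  "pr1 C X Y = fst (projs C X Y)"

definition pr2 :: "('o, 'm) cat \<Rightarrow> 'o \<Rightarrow> 'o \<Rightarrow> 'm" where
  "pr2 C X Y = snd (projs C X Y)"

definition prod_ob :: "('o, 'm) cat \<Rightarrow> 'o \<Rightarrow> 'o \<Rightarrow> 'o" where
  "prod_ob C X Y = Dom C (pr1 C X Y)"

definition pairing :: "('o, 'm) cat \<Rightarrow> 'm \<Rightarrow> 'm \<Rightarrow> 'm" where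
  "pairing C a b = (THE h. h \<in> hom_set C (Dom C a) (prod_ob C (Cod C a) (Cod C b)) \<and>
     pr1 C (Cod C a) (Cod C b) \<cdot>\<^bsub>C\<^esub> h = a \<and> pr2 C (Cod C a) (Cod C b) \<cdot>\<^bsub>C\<^esub> h = b)"

definition prod_arr :: "('o, 'm) cat \<Rightarrow> 'm \<Rightarrow> 'm \<Rightarrow> 'm" where
  "prod_arr C f g =
     pairing C (f \<cdot>\<^bsub>C\<^esub> pr1 C (Dom C f) (Dom C g)) (g \<cdot>\<^bsub>C\<^esub> pr2 C (Dom C f) (Dom C g))"

text \<open>A subobject is the full isomorphism class of a monomorphism, so that equality of subobjects
  is equality of sets. The operations on subobjects below collect the results of the construction
  over all choices of representatives and of pullbacks or factorizations; in a regular category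
  the set obtained is again one isomorphism class.\<close>

definition sub_class :: "('o, 'm) cat \<Rightarrow> 'm \<Rightarrow> 'm set" where
  "sub_class C m = {n. monic C n \<and>
     (\<exists>i. isomorphism C i \<and> Dom C i = Dom C n \<and> Cod C i = Dom C m \<and> m \<cdot>\<^bsub>C\<^esub> i = n)}"

definition subobjects :: "('o, 'm) cat \<Rightarrow> 'o \<Rightarrow> 'm set set" where
  "subobjects C B = {sub_class C m |m. monic C m \<and> Cod C m = B}"

definition sub_le :: "('o, 'm) cat \<Rightarrow> 'm set \<Rightarrow> 'm set \<Rightarrow> bool" where
  "sub_le C R S \<longleftrightarrow> (\<exists>r \<in> R. \<exists>s \<in> S. \<exists>h \<in> hom_set C (Dom C r) (Dom C s). s \<cdot>\<^bsub>C\<^esub> h = r)"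

text \<open>The mono part of the regular epi--mono factorization of \<open>g\<close>.\<close>

definition img :: "('o, 'm) cat \<Rightarrow> 'm \<Rightarrow> 'm set" where
  "img C g = {m. monic C m \<and> (\<exists>e. regular_epi C e \<and> Cod C e = Dom C m \<and> m \<cdot>\<^bsub>C\<^esub> e = g)}"


section \<open>Relations\<close>

definition rels :: "('o, 'm) cat \<Rightarrow> 'o \<Rightarrow> 'm set set" where
  "rels C X = subobjects C (prod_ob C X X)"

definition diag :: "('o, 'm) cat \<Rightarrow> 'o \<Rightarrow> 'm set" where
  "diag C X = sub_class C (pairing C (Ident C X) (Ident C X))"

definition rel_op :: "('o, 'm) cat \<Rightarrow> 'o \<Rightarrow> 'm set \<Rightarrow> 'm set" where
  "rel_op C X R = {pairing C (pr2 C X X \<cdot>\<^bsub>C\<^esub> r) (pr1 C X X \<cdot>\<^bsub>C\<^esub> r) |r. r \<in> R}"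

text \<open>\<open>rel_comp C X S R\<close> is \<open>S R = S \<circ> R\<close>, i.e. \<open>x (S R) z\<close> iff \<open>x R y\<close> and \<open>y S z\<close> for some \<open>y\<close>.\<close>

definition rel_comp :: "('o, 'm) cat \<Rightarrow> 'o \<Rightarrow> 'm set \<Rightarrow> 'm set \<Rightarrow> 'm set" where
  "rel_comp C X S R = {m. \<exists>r \<in> R. \<exists>s \<in> S. \<exists>u v.
     is_pullback C (pr2 C X X \<cdot>\<^bsub>C\<^esub> r) (pr1 C X X \<cdot>\<^bsub>C\<^esub> s) u v \<and>
     m \<in> img C (pairing C ((pr1 C X X \<cdot>\<^bsub>C\<^esub> r) \<cdot>\<^bsub>C\<^esub> u) ((pr2 C X X \<cdot>\<^bsub>C\<^esub> s) \<cdot>\<^bsub>C\<^esub> v))}"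

definition inv_img :: "('o, 'm) cat \<Rightarrow> 'm \<Rightarrow> 'm set \<Rightarrow> 'm set" where
  "inv_img C f S = {m. \<exists>s \<in> S. \<exists>g. is_pullback C (prod_arr C f f) s m g}"

definition dir_img :: "('o, 'm) cat \<Rightarrow> 'm \<Rightarrow> 'm set \<Rightarrow> 'm set" where
  "dir_img C f R = {m. \<exists>r \<in> R. m \<in> img C (prod_arr C f f \<cdot>\<^bsub>C\<^esub> r)}"

definition ker_rel :: "('o, 'm) cat \<Rightarrow> 'm \<Rightarrow> 'm set" where
  "ker_rel C f = inv_img C f (diag C (Cod C f))"

definition reflexive_rels :: "('o, 'm) cat \<Rightarrow> 'o \<Rightarrow> 'm set set" where
  "reflexive_rels C X = {R \<in> rels C X. sub_le C (diag C X) R}"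

definition preorder_rels :: "('o, 'm) cat \<Rightarrow> 'o \<Rightarrow> 'm set set" where
  "preorder_rels C X = {R \<in> reflexive_rels C X. sub_le C (rel_comp C X R R) R}"

definition equivalence_rels :: "('o, 'm) cat \<Rightarrow> 'o \<Rightarrow> 'm set set" where
  "equivalence_rels C X = {R \<in> preorder_rels C X. sub_le C (rel_op C X R) R}"

text \<open>A set of relations ordered by inclusion, as an ordered set of \<open>HOL-Algebra\<close>.\<close>

definition incl_order :: "('o, 'm) cat \<Rightarrow> 'm set set \<Rightarrow> 'm set gorder" where
  "incl_order C K = \<lparr>carrier = K, eq = (=), le = sub_le C\<rparr>"


section \<open>Chains of reflexive relations\<close>

definition reflexive_chain :: "('o, 'm) cat \<Rightarrow> 'o \<Rightarrow> (nat \<Rightarrow> 'm set) \<Rightarrow> bool" where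
  "reflexive_chain C X R \<longleftrightarrow> (\<forall>i. R i \<in> reflexive_rels C X \<and> sub_le C (R i) (R (Suc i)))"

definition chain_sup :: "('o, 'm) cat \<Rightarrow> 'o \<Rightarrow> (nat \<Rightarrow> 'm set) \<Rightarrow> 'm set" where
  "chain_sup C X R = \<Squnion>\<^bsub>incl_order C (reflexive_rels C X)\<^esub> (range R)"

fun alt_prod :: "('o, 'm) cat \<Rightarrow> 'o \<Rightarrow> 'm set \<Rightarrow> 'm set \<Rightarrow> nat \<Rightarrow> 'm set" where
  "alt_prod C X R S 0 = diag C X"
| "alt_prod C X R S (Suc 0) = R"
| "alt_prod C X R S (Suc (Suc n)) = rel_comp C X R (alt_prod C X S R (Suc n))"

definition alt_sup :: "('o, 'm) cat \<Rightarrow> 'o \<Rightarrow> 'm set \<Rightarrow> 'm set \<Rightarrow> 'm set" where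
  "alt_sup C X R S = chain_sup C X (alt_prod C X R S)"


section \<open>Categories of relations and cocartesian maps\<close>

text \<open>An arrow of \<open>Ref_cat C\<close> records its domain and codomain: it is a triple \<open>(A, f, B)\<close> with
  \<open>A = (X, R)\<close> and \<open>B = (Y, S)\<close>.\<close>

definition Ref_cat :: "('o, 'm) cat \<Rightarrow>
    ('o \<times> 'm set, ('o \<times> 'm set) \<times> 'm \<times> ('o \<times> 'm set)) cat" where
  "Ref_cat C =
    \<lparr>Ob = {(X, R). X \<in> Ob C \<and> R \<in> reflexive_rels C X},
     Arr = {((X, R), f, (Y, S)). X \<in> Ob C \<and> R \<in> reflexive_rels C X \<and>
              Y \<in> Ob C \<and> S \<in> reflexive_rels C Y \<and>
              f \<in> hom_set C X Y \<and> sub_le C R (inv_img C f S)},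
     Dom = (\<lambda>(A, f, B). A),
     Cod = (\<lambda>(A, f, B). B),
     Ident = (\<lambda>(X, R). ((X, R), Ident C X, (X, R))),
     Comp = (\<lambda>(B', g, D) (A, f, B). (A, g \<cdot>\<^bsub>C\<^esub> f, D))\<rparr>"

definition full_subcat :: "('o, 'm) cat \<Rightarrow> 'o set \<Rightarrow> ('o, 'm) cat" where
  "full_subcat C K =
    C\<lparr>Ob := {X \<in> Ob C. X \<in> K}, Arr := {f \<in> Arr C. Dom C f \<in> K \<and> Cod C f \<in> K}\<rparr>"

definition PrO_cat :: "('o, 'm) cat \<Rightarrow>
    ('o \<times> 'm set, ('o \<times> 'm set) \<times> 'm \<times> ('o \<times> 'm set)) cat" where
  "PrO_cat C = full_subcat (Ref_cat C) {(X, R). R \<in> preorder_rels C X}"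

definition Equ_cat :: "('o, 'm) cat \<Rightarrow>
    ('o \<times> 'm set, ('o \<times> 'm set) \<times> 'm \<times> ('o \<times> 'm set)) cat" where
  "Equ_cat C = full_subcat (Ref_cat C) {(X, R). R \<in> equivalence_rels C X}"

text \<open>The forgetful functor to the ground category, on objects and on arrows.\<close>

definition ground_ob :: "'o \<times> 'm set \<Rightarrow> 'o" where
  "ground_ob = fst"

definition ground_arr :: "('o \<times> 'm set) \<times> 'm \<times> ('o \<times> 'm set) \<Rightarrow> 'm" where
  "ground_arr = (\<lambda>(A, f, B). f)"

text \<open>\<open>UO\<close> and \<open>UA\<close> are the object and arrow parts of a functor from \<open>C\<close> to \<open>D\<close>.\<close>

definition cocartesian ::
    "('o, 'm) cat \<Rightarrow> ('p, 'n) cat \<Rightarrow> ('o \<Rightarrow> 'p) \<Rightarrow> ('m \<Rightarrow> 'n) \<Rightarrow> 'm \<Rightarrow> bool" where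
  "cocartesian C D UO UA f \<longleftrightarrow> f \<in> Arr C \<and>
    (\<forall>\<phi> \<in> Arr C. Dom C \<phi> = Dom C f \<and> UA \<phi> = UA f \<longrightarrow>
      (\<exists>!\<psi>. \<psi> \<in> hom_set C (Cod C f) (Cod C \<phi>) \<and> \<psi> \<cdot>\<^bsub>C\<^esub> f = \<phi> \<and>
            UA \<psi> = Ident D (UO (Cod C f))))"

end

theory Submission
  imports Defs
begin

text \<open>
  Relations are studied through their generalized elements: arrows \<open>a, b : Z \<rightarrow> X\<close> are related by \<open>R\<close>
  when the pair \<open>(a, b)\<close> factors through a representative of \<open>R\<close>. Inclusion of relations is
  inclusion of the related pairs (\<open>sub_le_iff\<close>). Diagonals, opposites and inverse images are described
  pointwise, whereas composites and direct images are described locally, that is, after restriction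
  along a regular epimorphism into \<open>Z\<close> (\<open>related_comp_iff\<close>, \<open>related_dir_img_iff\<close>). Membership in a
  relation descends along regular epimorphisms (\<open>related_descent\<close>), because these are orthogonal to
  monomorphisms. So inclusions between composites are proved as in the category of sets, each local
  witness being discharged by a descent.

  Let \<open>A\<close> be the supremum of the chain \<open>((R, S))\<close> for preorders \<open>R\<close> and \<open>S\<close>. Since \<open>R R \<subseteq> R\<close>, left
  multiplication by \<open>R\<close> keeps \<open>(R, S)\<^sub>n\<close> below \<open>(R, S)\<^sub>n\<^sub>+\<^sub>1\<close>, and \<open>S (R, S)\<^sub>n\<close> is a term of
  \<open>((S, R))\<close>, which is interleaved with \<open>((R, S))\<close>. Stability of suprema then yields \<open>R A \<subseteq> A\<close> and
  \<open>S A \<subseteq> A\<close>, so \<open>(R, S)\<^sub>n A \<subseteq> A\<close> for all \<open>n\<close>, and stability once more yields \<open>A A \<subseteq> A\<close>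
  (\<open>alt_sup_preorder\<close>). The first use has the chain as the right factor and the second as the left
  one; the hypothesis speaks of the left factor only, and passing to opposite relations gives the
  other side (\<open>comp_chain_sup_le\<close>). Every preorder containing \<open>R\<close> and \<open>S\<close> contains all alternating
  products, so \<open>A\<close> is the join. If \<open>R\<close> and \<open>S\<close> are symmetric, the converse of an alternating product
  is again a product of \<open>R\<close> and \<open>S\<close>, hence lies in \<open>A\<close>, and \<open>A\<close> is symmetric.

  For the cocartesian map, let \<open>Q\<close> be the join of \<open>T\<close> with the kernel relation of \<open>f\<close>. If \<open>T\<close> lies in
  the inverse image of a preorder \<open>S\<close> on \<open>Y\<close>, so does \<open>Q\<close>: this inverse image is a preorder, and it
  contains the kernel relation by reflexivity of \<open>S\<close>. By adjointness of direct and inverse images, the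
  direct image of \<open>Q\<close> lies in \<open>S\<close>, which is the required arrow over the identity of \<open>Y\<close>. The direct
  image is itself a preorder because \<open>Q\<close> contains the kernel relation (\<open>dir_img_preorder\<close>).
\<close>

section \<open>Arrows, pullbacks and regular epimorphisms\<close>

context category
begin

lemmas typing [simp] = Dom_Ob Cod_Ob Ident_Arr Dom_Ident Cod_Ident Comp_Arr Dom_Comp Cod_Comp
  Comp_assoc

lemma Comp_Ident_Dom [simp]: "f \<in> Arr C \<Longrightarrow> Dom C f = X \<Longrightarrow> f \<cdot> Ident C X = f"
  using Comp_Ident by blast

lemma Ident_Comp_Cod [simp]: "f \<in> Arr C \<Longrightarrow> Cod C f = Y \<Longrightarrow> Ident C Y \<cdot> f = f"
  using Ident_Comp by blast

lemma Comp_eq_extend: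
  assumes "g \<cdot> f = g' \<cdot> f'" and "h \<in> Arr C" "f \<in> Arr C" "g \<in> Arr C" "f' \<in> Arr C" "g' \<in> Arr C"
    and "Cod C h = Dom C f" "Cod C f = Dom C g" "Dom C f' = Dom C f" "Cod C f' = Dom C g'"
  shows "g \<cdot> (f \<cdot> h) = g' \<cdot> (f' \<cdot> h)"
  using assms by (metis Comp_assoc)

lemma Comp_eq_extend_single:
  assumes "g \<cdot> f = k" and "h \<in> Arr C" "f \<in> Arr C" "g \<in> Arr C"
    and "Cod C h = Dom C f" "Cod C f = Dom C g"
  shows "g \<cdot> (f \<cdot> h) = k \<cdot> h"
  using assms by (metis Comp_assoc)

lemma monic_Arr: "monic C m \<Longrightarrow> m \<in> Arr C"
  by (simp add: monic_def)

lemma monic_cancel: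
  assumes "monic C m" "m \<cdot> u = m \<cdot> v" "u \<in> Arr C" "v \<in> Arr C" "Dom C u = Dom C v"
    "Cod C u = Dom C m" "Cod C v = Dom C m"
  shows "u = v"
  using assms unfolding monic_def by blast

lemma isomorphismE:
  assumes "isomorphism C i"
  obtains j where "i \<in> Arr C" "j \<in> Arr C" "Dom C j = Cod C i" "Cod C j = Dom C i"
    "j \<cdot> i = Ident C (Dom C i)" "i \<cdot> j = Ident C (Cod C i)"
  using assms unfolding isomorphism_def hom_set_def by blast

lemma isomorphismI:
  assumes "i \<in> Arr C" "j \<in> Arr C" "Dom C j = Cod C i" "Cod C j = Dom C i"
    "j \<cdot> i = Ident C (Dom C i)" "i \<cdot> j = Ident C (Cod C i)"
  shows "isomorphism C i"
  using assms unfolding isomorphism_def hom_set_def by blast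

lemma isomorphism_Ident: "X \<in> Ob C \<Longrightarrow> isomorphism C (Ident C X)"
  by (rule isomorphismI[of _ "Ident C X"]) simp_all

lemma isomorphism_Arr: "isomorphism C i \<Longrightarrow> i \<in> Arr C"
  unfolding isomorphism_def by blast

lemma mutual_factor_isomorphism:
  assumes m: "monic C m" and n: "monic C n"
    and h: "h \<in> Arr C" "Dom C h = Dom C n" "Cod C h = Dom C m" "m \<cdot> h = n"
    and k: "k \<in> Arr C" "Dom C k = Dom C m" "Cod C k = Dom C n" "n \<cdot> k = m"
  shows "isomorphism C h"
proof -
  note [simp] = monic_Arr[OF m] monic_Arr[OF n] h(1-3) k(1-3)
  have "m \<cdot> (h \<cdot> k) = m \<cdot> Ident C (Dom C m)"
    using Comp_eq_extend_single[OF h(4), of k] k(4) by simp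
  then have hk: "h \<cdot> k = Ident C (Dom C m)"
    by (rule monic_cancel[OF m]) simp_all
  have "n \<cdot> (k \<cdot> h) = n \<cdot> Ident C (Dom C n)"
    using Comp_eq_extend_single[OF k(4), of h] h(4) by simp
  then have "k \<cdot> h = Ident C (Dom C n)"
    by (rule monic_cancel[OF n]) simp_all
  with hk show ?thesis
    by (intro isomorphismI[of h k]) simp_all
qed

lemma isomorphism_comp:
  assumes "isomorphism C i" "isomorphism C j" "Cod C i = Dom C j"
  shows "isomorphism C (j \<cdot> i)"
proof -
  obtain i' where [simp]: "i \<in> Arr C" "i' \<in> Arr C" "Dom C i' = Cod C i" "Cod C i' = Dom C i"
    and i: "i' \<cdot> i = Ident C (Dom C i)" "i \<cdot> i' = Ident C (Cod C i)"
    using assms(1) by (rule isomorphismE)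
  obtain j' where [simp]: "j \<in> Arr C" "j' \<in> Arr C" "Dom C j' = Cod C j" "Cod C j' = Dom C j"
    and j: "j' \<cdot> j = Ident C (Dom C j)" "j \<cdot> j' = Ident C (Cod C j)"
    using assms(2) by (rule isomorphismE)
  note [simp] = assms(3)
  have "j' \<cdot> (j \<cdot> i) = i"
    using Comp_eq_extend_single[OF j(1), of i] by simp
  then have 1: "(i' \<cdot> j') \<cdot> (j \<cdot> i) = Ident C (Dom C (j \<cdot> i))"
    using i by simp
  have "i \<cdot> (i' \<cdot> j') = j'"
    using Comp_eq_extend_single[OF i(2), of j'] by simp
  then have 2: "(j \<cdot> i) \<cdot> (i' \<cdot> j') = Ident C (Cod C (j \<cdot> i))"
    using j by simp
  show ?thesis
    by (rule isomorphismI[OF _ _ _ _ 1 2]) simp_all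
qed

text \<open>Transport along isomorphisms enters because a subobject is the whole class of its
  representatives: each construction on relations has to be shown closed under them.\<close>

lemma monic_comp_iso:
  assumes "monic C m" "isomorphism C i" "Cod C i = Dom C m"
  shows "monic C (m \<cdot> i)"
proof -
  note [simp] = monic_Arr[OF assms(1)] assms(3)
  obtain j where [simp]: "i \<in> Arr C" "j \<in> Arr C" "Dom C j = Cod C i" "Cod C j = Dom C i"
    and ji: "j \<cdot> i = Ident C (Dom C i)"
    using assms(2) by (rule isomorphismE)
  show ?thesis
    unfolding monic_def
  proof (intro conjI ballI impI)
    fix u v
    assume "u \<in> Arr C" "v \<in> Arr C"
      and a: "Dom C u = Dom C v \<and> Cod C u = Dom C (m \<cdot> i) \<and> Cod C v = Dom C (m \<cdot> i) \<and>
        (m \<cdot> i) \<cdot> u = (m \<cdot> i) \<cdot> v"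
    then have [simp]: "Cod C u = Dom C i" "Cod C v = Dom C i"
      by simp_all
    have "(m \<cdot> i) \<cdot> u = (m \<cdot> i) \<cdot> v"
      using a by blast
    then have "m \<cdot> (i \<cdot> u) = m \<cdot> (i \<cdot> v)"
      using \<open>u \<in> Arr C\<close> \<open>v \<in> Arr C\<close> by simp
    then have iu: "i \<cdot> u = i \<cdot> v"
      by (rule monic_cancel[OF assms(1)]) (use a \<open>u \<in> Arr C\<close> \<open>v \<in> Arr C\<close> in simp_all)
    have "j \<cdot> (i \<cdot> w) = w" if "w \<in> Arr C" "Cod C w = Dom C i" for w
      using Comp_eq_extend_single[OF ji, of w] that by simp
    then show "u = v"
      using iu a \<open>u \<in> Arr C\<close> \<open>v \<in> Arr C\<close> by (metis Dom_Comp \<open>i \<in> Arr C\<close> \<open>m \<in> Arr C\<close> assms(3))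
  qed simp
qed

lemma sub_class_self:
  assumes "monic C m"
  shows "m \<in> sub_class C m"
proof -
  have "isomorphism C (Ident C (Dom C m))"
    by (simp add: isomorphism_Ident monic_Arr[OF assms])
  then show ?thesis
    using assms monic_Arr[OF assms] unfolding sub_class_def
    by (auto intro!: exI[of _ "Ident C (Dom C m)"])
qed

lemma pullbackD:
  assumes "is_pullback C f g p q"
  shows "f \<in> Arr C" "g \<in> Arr C" "p \<in> Arr C" "q \<in> Arr C" "Cod C g = Cod C f"
    "Dom C q = Dom C p" "Cod C p = Dom C f" "Cod C q = Dom C g" "f \<cdot> p = g \<cdot> q"
  using assms unfolding is_pullback_def by simp_all

lemma ex1_pullback_lift:
  assumes "is_pullback C f g p q" "a \<in> Arr C" "b \<in> Arr C" "Dom C a = Dom C b"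
    "Cod C a = Dom C f" "Cod C b = Dom C g" "f \<cdot> a = g \<cdot> b"
  shows "\<exists>!h. h \<in> hom_set C (Dom C a) (Dom C p) \<and> p \<cdot> h = a \<and> q \<cdot> h = b"
  using assms unfolding is_pullback_def by blast

lemma pullback_cancel:
  assumes pb: "is_pullback C f g p q" and "h \<in> Arr C" "k \<in> Arr C" "Dom C h = Dom C k"
    "Cod C h = Dom C p" "Cod C k = Dom C p" and eqs: "p \<cdot> h = p \<cdot> k" "q \<cdot> h = q \<cdot> k"
  shows "h = k"
proof -
  note [simp] = pullbackD(1-8)[OF pb] assms(2-6)
  have "f \<cdot> (p \<cdot> h) = g \<cdot> (q \<cdot> h)"
    by (rule Comp_eq_extend[OF pullbackD(9)[OF pb]]) simp_all
  then have "\<exists>!l. l \<in> hom_set C (Dom C (p \<cdot> h)) (Dom C p) \<and> p \<cdot> l = p \<cdot> h \<and> q \<cdot> l = q \<cdot> h"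
    by (intro ex1_pullback_lift[OF pb]) simp_all
  moreover have "h \<in> hom_set C (Dom C (p \<cdot> h)) (Dom C p)" "k \<in> hom_set C (Dom C (p \<cdot> h)) (Dom C p)"
    by (simp_all add: hom_set_def)
  ultimately show ?thesis
    using eqs by metis
qed

lemma coequalizerD:
  assumes "is_coequalizer C u v e"
  shows "u \<in> Arr C" "v \<in> Arr C" "e \<in> Arr C" "Dom C v = Dom C u" "Cod C v = Cod C u"
    "Dom C e = Cod C u" "e \<cdot> u = e \<cdot> v"
  using assms unfolding is_coequalizer_def by simp_all

lemma ex1_coequalizer_factor:
  assumes "is_coequalizer C u v e" "a \<in> Arr C" "Dom C a = Cod C u" "a \<cdot> u = a \<cdot> v"
  shows "\<exists>!h. h \<in> hom_set C (Cod C e) (Cod C a) \<and> h \<cdot> e = a"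
  using assms unfolding is_coequalizer_def by blast

lemma coequalizer_factor:
  assumes "is_coequalizer C u v e" "a \<in> Arr C" "Dom C a = Cod C u" "a \<cdot> u = a \<cdot> v"
  obtains h where "h \<in> Arr C" "Dom C h = Cod C e" "Cod C h = Cod C a" "h \<cdot> e = a"
  using ex1_coequalizer_factor[OF assms] unfolding hom_set_def by blast

lemma regular_epi_Arr: "regular_epi C e \<Longrightarrow> e \<in> Arr C"
  unfolding regular_epi_def using coequalizerD(3) by blast

lemma regular_epi_cancel:
  assumes "regular_epi C e" and hk: "h \<in> Arr C" "k \<in> Arr C" "Dom C h = Cod C e" "Dom C k = Cod C e"
    "Cod C h = Cod C k" and eq: "h \<cdot> e = k \<cdot> e"
  shows "h = k"
proof -
  obtain u v where ce: "is_coequalizer C u v e"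
    using assms(1) unfolding regular_epi_def by blast
  note [simp] = coequalizerD(1-6)[OF ce] hk
  have "h \<cdot> (e \<cdot> u) = h \<cdot> (e \<cdot> v)"
    by (simp only: coequalizerD(7)[OF ce])
  then have "\<exists>!l. l \<in> hom_set C (Cod C e) (Cod C (h \<cdot> e)) \<and> l \<cdot> e = h \<cdot> e"
    by (intro ex1_coequalizer_factor[OF ce]) simp_all
  moreover have "h \<in> hom_set C (Cod C e) (Cod C (h \<cdot> e))" "k \<in> hom_set C (Cod C e) (Cod C (h \<cdot> e))"
    by (simp_all add: hom_set_def)
  ultimately show ?thesis
    using eq by metis
qed

lemma regular_epi_Ident:
  assumes [simp]: "X \<in> Ob C"
  shows "regular_epi C (Ident C X)"
proof -
  have "is_coequalizer C (Ident C X) (Ident C X) (Ident C X)"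
    unfolding is_coequalizer_def hom_set_def by auto
  then show ?thesis
    unfolding regular_epi_def by blast
qed

lemma iso_comp_regular_epi:
  assumes "regular_epi C e" "isomorphism C i" "Dom C i = Cod C e"
  shows "regular_epi C (i \<cdot> e)"
proof -
  obtain u v where ce: "is_coequalizer C u v e"
    using assms(1) unfolding regular_epi_def by blast
  obtain j where j [simp]: "i \<in> Arr C" "j \<in> Arr C" "Dom C j = Cod C i" "Cod C j = Dom C i"
    and ji: "j \<cdot> i = Ident C (Dom C i)" and ij: "i \<cdot> j = Ident C (Cod C i)"
    using assms(2) by (rule isomorphismE)
  note [simp] = coequalizerD(1-6)[OF ce] assms(3)
  have ie: "is_coequalizer C u v (i \<cdot> e)"
    unfolding is_coequalizer_def
  proof (intro conjI ballI impI)
    show "(i \<cdot> e) \<cdot> u = (i \<cdot> e) \<cdot> v"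
      using coequalizerD(7)[OF ce] by simp
  next
    fix a
    assume a: "a \<in> Arr C" "Dom C a = Cod C u \<and> a \<cdot> u = a \<cdot> v"
    obtain h where h: "h \<in> Arr C" "Dom C h = Cod C e" "Cod C h = Cod C a" "h \<cdot> e = a"
      using coequalizer_factor[OF ce, of a] a by blast
    show "\<exists>!k. k \<in> hom_set C (Cod C (i \<cdot> e)) (Cod C a) \<and> k \<cdot> (i \<cdot> e) = a"
    proof (rule ex1I[of _ "h \<cdot> j"])
      have "j \<cdot> (i \<cdot> e) = e"
        using Comp_eq_extend_single[OF ji, of e] by simp
      then show "h \<cdot> j \<in> hom_set C (Cod C (i \<cdot> e)) (Cod C a) \<and> (h \<cdot> j) \<cdot> (i \<cdot> e) = a"
        using h by (simp add: hom_set_def)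
    next
      fix k
      assume k: "k \<in> hom_set C (Cod C (i \<cdot> e)) (Cod C a) \<and> k \<cdot> (i \<cdot> e) = a"
      then have [simp]: "k \<in> Arr C" "Dom C k = Cod C i" "Cod C k = Cod C a"
        by (auto simp: hom_set_def)
      have "k \<cdot> i = h"
        by (rule regular_epi_cancel[OF assms(1)]) (use h k in simp_all)
      then have "h \<cdot> j = k \<cdot> (i \<cdot> j)"
        by auto
      then show "k = h \<cdot> j"
        by (simp add: ij)
    qed
  qed simp_all
  then show ?thesis
    unfolding regular_epi_def by blast
qed

text \<open>Regular epimorphisms are orthogonal to monomorphisms: \<open>h\<close> coequalizes every pair that
  \<open>e\<close> coequalizes, because \<open>m\<close> can be cancelled.\<close>

lemma regular_epi_descent:
  assumes e: "regular_epi C e" and m: "monic C m" and w: "w \<in> Arr C" "Dom C w = Cod C e" "Cod C w = Cod C m"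
    and h: "h \<in> Arr C" "Dom C h = Dom C e" "Cod C h = Dom C m" and eq: "m \<cdot> h = w \<cdot> e"
  obtains k where "k \<in> Arr C" "Dom C k = Cod C e" "Cod C k = Dom C m" "m \<cdot> k = w" "k \<cdot> e = h"
proof -
  obtain u v where ce: "is_coequalizer C u v e"
    using e unfolding regular_epi_def by blast
  note [simp] = coequalizerD(1-6)[OF ce] monic_Arr[OF m] w h(1,3)
  have [simp]: "Dom C h = Cod C u"
    using h by simp
  have "m \<cdot> (h \<cdot> u) = w \<cdot> (e \<cdot> u)" "m \<cdot> (h \<cdot> v) = w \<cdot> (e \<cdot> v)"
    by (rule Comp_eq_extend[OF eq]; simp)+
  then have "m \<cdot> (h \<cdot> u) = m \<cdot> (h \<cdot> v)"
    using coequalizerD(7)[OF ce] by simp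
  then have "h \<cdot> u = h \<cdot> v"
    by (rule monic_cancel[OF m]) simp_all
  then obtain k where [simp]: "k \<in> Arr C" "Dom C k = Cod C e" "Cod C k = Cod C h" and ke: "k \<cdot> e = h"
    using coequalizer_factor[OF ce, of h] by auto
  have "m \<cdot> k = w"
    by (rule regular_epi_cancel[OF e]) (simp_all add: ke eq)
  then show ?thesis
    by (intro that[of k]) (simp_all add: ke)
qed

end

section \<open>Image factorization and products\<close>

context regular_category
begin

text \<open>Let \<open>e\<close> be the coequalizer of the kernel pair of \<open>f = m \<cdot> e\<close>. If \<open>m \<cdot> u = m \<cdot> v\<close>, then \<open>u\<close>
  and \<open>v\<close> lift along \<open>e\<close> after two successive pullbacks of \<open>e\<close>; the two lifts have the same image
  under \<open>f\<close>, so \<open>e\<close> identifies them. Hence \<open>u\<close> and \<open>v\<close> agree after a composite of two regular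
  epimorphisms, and are equal.\<close>

lemma regular_epi_mono_factorization:
  assumes [simp]: "f \<in> Arr C"
  obtains e m where "regular_epi C e" "monic C m" "Dom C e = Dom C f" "Cod C m = Cod C f"
    "Dom C m = Cod C e" "m \<cdot> e = f"
proof -
  obtain p q where kp: "is_pullback C f f p q"
    using ex_pullback[of f f] by auto
  obtain e where ce: "is_coequalizer C p q e"
    using ex_coequalizer_kernel_pair[OF kp] by blast
  then have re: "regular_epi C e"
    unfolding regular_epi_def by blast
  note [simp] = pullbackD(3-8)[OF kp] coequalizerD(3)[OF ce]
  have [simp]: "Dom C e = Dom C f"
    using coequalizerD(6)[OF ce] by simp
  have "Dom C f = Cod C p"
    by simp
  then obtain m where [simp]: "m \<in> Arr C" "Dom C m = Cod C e" "Cod C m = Cod C f" and me: "m \<cdot> e = f"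
    using coequalizer_factor[OF ce assms _ pullbackD(9)[OF kp]] by blast
  have "monic C m"
    unfolding monic_def
  proof (intro conjI ballI impI)
    fix u v
    assume "u \<in> Arr C" "v \<in> Arr C"
      and uv: "Dom C u = Dom C v \<and> Cod C u = Dom C m \<and> Cod C v = Dom C m \<and> m \<cdot> u = m \<cdot> v"
    note [simp] = \<open>u \<in> Arr C\<close> \<open>v \<in> Arr C\<close>
    have [simp]: "Dom C u = Dom C v" "Cod C u = Cod C e" "Cod C v = Cod C e"
      and muv: "m \<cdot> u = m \<cdot> v"
      using uv \<open>Dom C m = Cod C e\<close> by metis+
    obtain x d where pb1: "is_pullback C e u x d"
      using ex_pullback[of e u] by auto
    note [simp] = pullbackD(3-8)[OF pb1]
    obtain y d' where pb2: "is_pullback C e (v \<cdot> d) y d'"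
      using ex_pullback[of e "v \<cdot> d"] by auto
    note [simp] = pullbackD(3,4,6,7)[OF pb2]
    have [simp]: "Cod C d' = Dom C x"
      using pullbackD(8)[OF pb2] by simp
    have rd: "regular_epi C d" "regular_epi C d'"
      using regular_epi_stable[OF pb1 re] regular_epi_stable[OF pb2 re] by auto
    have ex: "e \<cdot> (x \<cdot> d') = u \<cdot> (d \<cdot> d')"
      by (rule Comp_eq_extend[OF pullbackD(9)[OF pb1]]) simp_all
    have ey: "e \<cdot> y = v \<cdot> (d \<cdot> d')"
      using pullbackD(9)[OF pb2] by simp
    have "f \<cdot> (x \<cdot> d') = m \<cdot> (e \<cdot> (x \<cdot> d'))"
      by (subst me[symmetric]) simp
    also have "\<dots> = m \<cdot> (v \<cdot> (d \<cdot> d'))"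
      unfolding ex by (rule Comp_eq_extend[OF muv]) simp_all
    also have "\<dots> = f \<cdot> y"
      unfolding ey[symmetric] by (subst me[symmetric]) simp
    finally have fxy: "f \<cdot> (x \<cdot> d') = f \<cdot> y" .
    have "\<exists>!h. h \<in> hom_set C (Dom C (x \<cdot> d')) (Dom C p) \<and> p \<cdot> h = x \<cdot> d' \<and> q \<cdot> h = y"
      by (rule ex1_pullback_lift[OF kp]) (simp_all add: fxy)
    then obtain h where [simp]: "h \<in> Arr C" "Cod C h = Dom C p" and h: "p \<cdot> h = x \<cdot> d'" "q \<cdot> h = y"
      unfolding hom_set_def by blast
    have "e \<cdot> (p \<cdot> h) = e \<cdot> (q \<cdot> h)"
      by (rule Comp_eq_extend[OF coequalizerD(7)[OF ce]]) simp_all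
    then have "u \<cdot> (d \<cdot> d') = v \<cdot> (d \<cdot> d')"
      using h ex ey by simp
    then have "(u \<cdot> d) \<cdot> d' = (v \<cdot> d) \<cdot> d'"
      by simp
    then have "u \<cdot> d = v \<cdot> d"
      by (rule regular_epi_cancel[OF rd(2), rotated -1]) simp_all
    then show "u = v"
      by (rule regular_epi_cancel[OF rd(1), rotated -1]) simp_all
  qed simp
  from that[OF re this \<open>Dom C e = Dom C f\<close> \<open>Cod C m = Cod C f\<close> \<open>Dom C m = Cod C e\<close> me] show ?thesis .
qed

lemma ex_product:
  assumes "X \<in> Ob C" "Y \<in> Ob C"
  shows "\<exists>p q. is_product C X Y p q"
proof -
  obtain t where t: "is_terminal C t"
    using ex_terminal by blast
  then obtain a b where [simp]: "a \<in> Arr C" "Dom C a = X" "Cod C a = t"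
    "b \<in> Arr C" "Dom C b = Y" "Cod C b = t"
    using assms unfolding is_terminal_def hom_set_def by blast
  obtain p q where pb: "is_pullback C a b p q"
    using ex_pullback[of a b] by auto
  have "a \<cdot> c = b \<cdot> d" if "c \<in> Arr C" "d \<in> Arr C" "Dom C c = Dom C d" "Cod C c = X" "Cod C d = Y" for c d
  proof -
    have "a \<cdot> c \<in> hom_set C (Dom C d) t" "b \<cdot> d \<in> hom_set C (Dom C d) t"
      using that by (auto simp: hom_set_def)
    moreover have "\<exists>!h. h \<in> hom_set C (Dom C d) t"
      using t that unfolding is_terminal_def by auto
    ultimately show ?thesis by blast
  qed
  then have "is_product C X Y p q"
    using pullbackD(3,4,6-8)[OF pb] ex1_pullback_lift[OF pb] unfolding is_product_def by simp
  then show ?thesis by blast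
qed

lemma is_product_projs:
  assumes "X \<in> Ob C" "Y \<in> Ob C"
  shows "is_product C X Y (pr1 C X Y) (pr2 C X Y)"
proof -
  have "\<exists>pq. is_product C X Y (fst pq) (snd pq)"
    using ex_product[OF assms] by auto
  then show ?thesis
    unfolding pr1_def pr2_def projs_def by (rule someI_ex)
qed

lemma pr_typing [simp]:
  assumes "X \<in> Ob C" "Y \<in> Ob C"
  shows "pr1 C X Y \<in> Arr C" "pr2 C X Y \<in> Arr C" "Dom C (pr1 C X Y) = prod_ob C X Y"
    "Dom C (pr2 C X Y) = prod_ob C X Y" "Cod C (pr1 C X Y) = X" "Cod C (pr2 C X Y) = Y"
  using is_product_projs[OF assms] unfolding is_product_def prod_ob_def by argo+

lemma prod_ob_Ob [simp]: "X \<in> Ob C \<Longrightarrow> Y \<in> Ob C \<Longrightarrow> prod_ob C X Y \<in> Ob C"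
  unfolding prod_ob_def by (rule Dom_Ob) (rule pr_typing(1))

lemma ex1_product_lift:
  assumes "X \<in> Ob C" "Y \<in> Ob C" "a \<in> Arr C" "b \<in> Arr C" "Dom C b = Dom C a" "Cod C a = X" "Cod C b = Y"
  shows "\<exists>!h. h \<in> hom_set C (Dom C a) (prod_ob C X Y) \<and> pr1 C X Y \<cdot> h = a \<and> pr2 C X Y \<cdot> h = b"
proof -
  have "\<forall>a \<in> Arr C. \<forall>b \<in> Arr C. Dom C a = Dom C b \<and> Cod C a = X \<and> Cod C b = Y \<longrightarrow>
      (\<exists>!h. h \<in> hom_set C (Dom C a) (prod_ob C X Y) \<and> pr1 C X Y \<cdot> h = a \<and> pr2 C X Y \<cdot> h = b)"
    using is_product_projs[OF assms(1,2)] unfolding is_product_def prod_ob_def by (elim conjE)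
  from this[rule_format, of a b] show ?thesis
    by (simp only: assms simp_thms)
qed

lemma pr_jointly_monic:
  assumes "X \<in> Ob C" "Y \<in> Ob C" "g \<in> Arr C" "h \<in> Arr C" "Dom C g = Dom C h"
    "Cod C g = prod_ob C X Y" "Cod C h = prod_ob C X Y"
    "pr1 C X Y \<cdot> g = pr1 C X Y \<cdot> h" "pr2 C X Y \<cdot> g = pr2 C X Y \<cdot> h"
  shows "g = h"
proof -
  note [simp] = assms
  have "\<exists>!k. k \<in> hom_set C (Dom C (pr1 C X Y \<cdot> g)) (prod_ob C X Y) \<and>
      pr1 C X Y \<cdot> k = pr1 C X Y \<cdot> g \<and> pr2 C X Y \<cdot> k = pr2 C X Y \<cdot> g"
    by (rule ex1_product_lift) simp_all
  moreover have "g \<in> hom_set C (Dom C (pr1 C X Y \<cdot> g)) (prod_ob C X Y)"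
    "h \<in> hom_set C (Dom C (pr1 C X Y \<cdot> g)) (prod_ob C X Y)"
    by (simp_all add: hom_set_def)
  ultimately show ?thesis
    using assms(8,9) by metis
qed

lemma pairing_typing [simp]:
  assumes "a \<in> Arr C" "b \<in> Arr C" "Dom C b = Dom C a" "Cod C a = X" "Cod C b = Y"
  shows "pairing C a b \<in> Arr C" "Dom C (pairing C a b) = Dom C a"
    "Cod C (pairing C a b) = prod_ob C X Y"
    "pr1 C X Y \<cdot> pairing C a b = a" "pr2 C X Y \<cdot> pairing C a b = b"
proof -
  note [simp] = assms(1-3)
  have [simp]: "X \<in> Ob C" "Y \<in> Ob C"
    using assms by auto
  have "\<exists>!h. h \<in> hom_set C (Dom C a) (prod_ob C X Y) \<and> pr1 C X Y \<cdot> h = a \<and> pr2 C X Y \<cdot> h = b"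
    by (rule ex1_product_lift) (use assms in simp_all)
  from theI'[OF this] have "pairing C a b \<in> hom_set C (Dom C a) (prod_ob C X Y) \<and>
      pr1 C X Y \<cdot> pairing C a b = a \<and> pr2 C X Y \<cdot> pairing C a b = b"
    unfolding pairing_def using assms by simp
  then show "pairing C a b \<in> Arr C" "Dom C (pairing C a b) = Dom C a"
    "Cod C (pairing C a b) = prod_ob C X Y"
    "pr1 C X Y \<cdot> pairing C a b = a" "pr2 C X Y \<cdot> pairing C a b = b"
    by (auto simp: hom_set_def)
qed

lemma pr_pairing_comp [simp]:
  assumes "a \<in> Arr C" "b \<in> Arr C" "Dom C b = Dom C a" "Cod C a = X" "Cod C b = Y"
    "h \<in> Arr C" "Cod C h = Dom C a"
  shows "pr1 C X Y \<cdot> (pairing C a b \<cdot> h) = a \<cdot> h" "pr2 C X Y \<cdot> (pairing C a b \<cdot> h) = b \<cdot> h"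
proof -
  have "X \<in> Ob C" "Y \<in> Ob C"
    using assms by auto
  then show "pr1 C X Y \<cdot> (pairing C a b \<cdot> h) = a \<cdot> h" "pr2 C X Y \<cdot> (pairing C a b \<cdot> h) = b \<cdot> h"
    using assms by (simp_all add: Comp_eq_extend_single[OF pairing_typing(4)]
        Comp_eq_extend_single[OF pairing_typing(5)])
qed

lemma prod_arr_typing [simp]:
  assumes "f \<in> Arr C" "Dom C f = X" "Cod C f = Y"
  shows "prod_arr C f f \<in> Arr C" "Dom C (prod_arr C f f) = prod_ob C X X"
    "Cod C (prod_arr C f f) = prod_ob C Y Y"
proof -
  have "X \<in> Ob C"
    using assms by auto
  then show "prod_arr C f f \<in> Arr C" "Dom C (prod_arr C f f) = prod_ob C X X"
    "Cod C (prod_arr C f f) = prod_ob C Y Y"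
    using assms unfolding prod_arr_def by simp_all
qed

lemma pr_prod_arr_comp [simp]:
  assumes f: "f \<in> Arr C" "Dom C f = X" "Cod C f = Y" and h: "h \<in> Arr C" "Cod C h = prod_ob C X X"
  shows "pr1 C Y Y \<cdot> (prod_arr C f f \<cdot> h) = f \<cdot> (pr1 C X X \<cdot> h)"
    "pr2 C Y Y \<cdot> (prod_arr C f f \<cdot> h) = f \<cdot> (pr2 C X X \<cdot> h)"
proof -
  have "X \<in> Ob C"
    using f by auto
  then show "pr1 C Y Y \<cdot> (prod_arr C f f \<cdot> h) = f \<cdot> (pr1 C X X \<cdot> h)"
    "pr2 C Y Y \<cdot> (prod_arr C f f \<cdot> h) = f \<cdot> (pr2 C X X \<cdot> h)"
    using f h unfolding prod_arr_def by simp_all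
qed

end

section \<open>Generalized elements of relations\<close>

text \<open>A generalized element of \<open>X \<times> X\<close>, kept as its two components so that the chosen products
  stay out of the statements.\<close>

definition parallel :: "('o, 'm) cat \<Rightarrow> 'o \<Rightarrow> 'm \<Rightarrow> 'm \<Rightarrow> bool" where
  "parallel C X a b \<longleftrightarrow>
     a \<in> Arr C \<and> b \<in> Arr C \<and> Dom C b = Dom C a \<and> Cod C a = X \<and> Cod C b = X"

definition factors :: "('o, 'm) cat \<Rightarrow> 'o \<Rightarrow> 'm \<Rightarrow> 'm \<Rightarrow> 'm \<Rightarrow> bool" where
  "factors C X r a b \<longleftrightarrow> (\<exists>h \<in> hom_set C (Dom C a) (Dom C r).
     pr1 C X X \<cdot>\<^bsub>C\<^esub> (r \<cdot>\<^bsub>C\<^esub> h) = a \<and> pr2 C X X \<cdot>\<^bsub>C\<^esub> (r \<cdot>\<^bsub>C\<^esub> h) = b)"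

text \<open>\<open>related C X R a b\<close> is the relation \<open>R\<close> in the internal language: \<open>a R b\<close> for elements of \<open>X\<close>
  defined over a common domain.\<close>

definition related :: "('o, 'm) cat \<Rightarrow> 'o \<Rightarrow> 'm set \<Rightarrow> 'm \<Rightarrow> 'm \<Rightarrow> bool" where
  "related C X R a b \<longleftrightarrow> (\<exists>r \<in> R. factors C X r a b)"

lemma parallelD:
  assumes "parallel C X a b"
  shows "a \<in> Arr C" "b \<in> Arr C" "Dom C b = Dom C a" "Cod C a = X" "Cod C b = X"
  using assms unfolding parallel_def by blast+

lemma factorsI:
  assumes "h \<in> Arr C" "Dom C h = Dom C a" "Cod C h = Dom C r"
    "pr1 C X X \<cdot>\<^bsub>C\<^esub> (r \<cdot>\<^bsub>C\<^esub> h) = a" "pr2 C X X \<cdot>\<^bsub>C\<^esub> (r \<cdot>\<^bsub>C\<^esub> h) = b"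
  shows "factors C X r a b"
  using assms unfolding factors_def hom_set_def by blast

lemma factorsE:
  assumes "factors C X r a b"
  obtains h where "h \<in> Arr C" "Dom C h = Dom C a" "Cod C h = Dom C r"
    "pr1 C X X \<cdot>\<^bsub>C\<^esub> (r \<cdot>\<^bsub>C\<^esub> h) = a" "pr2 C X X \<cdot>\<^bsub>C\<^esub> (r \<cdot>\<^bsub>C\<^esub> h) = b"
  using assms unfolding factors_def hom_set_def by blast

context regular_category
begin

lemma factors_parallel:
  assumes "X \<in> Ob C" "r \<in> Arr C" "Cod C r = prod_ob C X X" "factors C X r a b"
  shows "parallel C X a b"
  using assms(4)
proof (rule factorsE)
  fix h
  assume "h \<in> Arr C" "Dom C h = Dom C a" "Cod C h = Dom C r"
    "pr1 C X X \<cdot> (r \<cdot> h) = a" "pr2 C X X \<cdot> (r \<cdot> h) = b"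
  then show ?thesis
    using assms(1-3) unfolding parallel_def by auto
qed

lemma factors_comp:
  assumes "X \<in> Ob C" "r \<in> Arr C" "Cod C r = prod_ob C X X" "factors C X r a b"
    and g: "g \<in> Arr C" "Cod C g = Dom C a"
  shows "factors C X r (a \<cdot> g) (b \<cdot> g)"
proof -
  note [simp] = assms(1-3) g parallelD[OF factors_parallel[OF assms(1-4)]]
  from assms(4) obtain h where [simp]: "h \<in> Arr C" "Dom C h = Dom C a" "Cod C h = Dom C r"
    and h: "pr1 C X X \<cdot> (r \<cdot> h) = a" "pr2 C X X \<cdot> (r \<cdot> h) = b"
    by (rule factorsE)
  have "pr1 C X X \<cdot> ((r \<cdot> h) \<cdot> g) = a \<cdot> g" "pr2 C X X \<cdot> ((r \<cdot> h) \<cdot> g) = b \<cdot> g"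
    by (rule Comp_eq_extend_single; simp add: h)+
  then show ?thesis
    by (intro factorsI[of "h \<cdot> g"]) simp_all
qed

text \<open>Truth is local: this is orthogonality applied to the pairing of \<open>a\<close> and \<open>b\<close>.\<close>

lemma factors_descent:
  assumes X: "X \<in> Ob C" and e: "regular_epi C e" and r: "monic C r" "Cod C r = prod_ob C X X"
    and ab: "parallel C X a b" "Cod C e = Dom C a" and f: "factors C X r (a \<cdot> e) (b \<cdot> e)"
  shows "factors C X r a b"
proof -
  note [simp] = X regular_epi_Arr[OF e] monic_Arr[OF r(1)] r(2) parallelD[OF ab(1)] ab(2)
  from f obtain h where h: "h \<in> Arr C" "Dom C h = Dom C (a \<cdot> e)" "Cod C h = Dom C r"
    "pr1 C X X \<cdot> (r \<cdot> h) = a \<cdot> e" "pr2 C X X \<cdot> (r \<cdot> h) = b \<cdot> e"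
    by (rule factorsE)
  have rh: "r \<cdot> h = pairing C a b \<cdot> e"
    by (rule pr_jointly_monic[of X X]) (use h in simp_all)
  obtain k where k: "k \<in> Arr C" "Dom C k = Cod C e" "Cod C k = Dom C r" "r \<cdot> k = pairing C a b"
    by (rule regular_epi_descent[OF e r(1) _ _ _ _ _ _ rh]) (use h in simp_all)
  show ?thesis
    by (rule factorsI[of k]) (use k in simp_all)
qed

lemma factors_mono:
  assumes "X \<in> Ob C" "r \<in> Arr C" "s \<in> Arr C" "Cod C s = prod_ob C X X"
    and k: "k \<in> Arr C" "Dom C k = Dom C r" "Cod C k = Dom C s" "s \<cdot> k = r"
    and f: "factors C X r a b"
  shows "factors C X s a b"
  using f
proof (rule factorsE)
  note [simp] = assms(1-4) k(1-3)
  fix h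
  assume [simp]: "h \<in> Arr C" "Dom C h = Dom C a" "Cod C h = Dom C r"
    and h: "pr1 C X X \<cdot> (r \<cdot> h) = a" "pr2 C X X \<cdot> (r \<cdot> h) = b"
  have "s \<cdot> (k \<cdot> h) = r \<cdot> h"
    by (rule Comp_eq_extend_single[OF k(4)]) simp_all
  then show ?thesis
    by (intro factorsI[of "k \<cdot> h"]) (simp_all add: h)
qed

text \<open>The two projections restricted to \<open>r\<close> are the universal pair of elements related by \<open>r\<close>;
  testing another arrow on this pair is the Yoneda step behind every comparison of relations.\<close>

lemma factors_projections_iff:
  assumes "X \<in> Ob C" "r \<in> Arr C" "s \<in> Arr C" "Cod C r = prod_ob C X X" "Cod C s = prod_ob C X X"
  shows "factors C X s (pr1 C X X \<cdot> r) (pr2 C X X \<cdot> r) \<longleftrightarrow>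
    (\<exists>h. h \<in> Arr C \<and> Dom C h = Dom C r \<and> Cod C h = Dom C s \<and> s \<cdot> h = r)"
proof
  note [simp] = assms
  assume "factors C X s (pr1 C X X \<cdot> r) (pr2 C X X \<cdot> r)"
  then obtain h where h: "h \<in> Arr C" "Dom C h = Dom C (pr1 C X X \<cdot> r)" "Cod C h = Dom C s"
    "pr1 C X X \<cdot> (s \<cdot> h) = pr1 C X X \<cdot> r" "pr2 C X X \<cdot> (s \<cdot> h) = pr2 C X X \<cdot> r"
    by (rule factorsE)
  have "s \<cdot> h = r"
    by (rule pr_jointly_monic[of X X]) (use h in simp_all)
  then show "\<exists>h. h \<in> Arr C \<and> Dom C h = Dom C r \<and> Cod C h = Dom C s \<and> s \<cdot> h = r"
    using h by (intro exI[of _ h]) simp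
next
  note [simp] = assms
  assume "\<exists>h. h \<in> Arr C \<and> Dom C h = Dom C r \<and> Cod C h = Dom C s \<and> s \<cdot> h = r"
  then obtain h where h: "h \<in> Arr C" "Dom C h = Dom C r" "Cod C h = Dom C s" "s \<cdot> h = r"
    by blast
  show "factors C X s (pr1 C X X \<cdot> r) (pr2 C X X \<cdot> r)"
    by (rule factorsI[of h]) (use h in simp_all)
qed

lemma factors_projections:
  assumes "X \<in> Ob C" "r \<in> Arr C" "Cod C r = prod_ob C X X"
  shows "factors C X r (pr1 C X X \<cdot> r) (pr2 C X X \<cdot> r)"
  using assms by (intro factorsI[of "Ident C (Dom C r)"]) simp_all

lemma relsE:
  assumes "R \<in> rels C X"
  obtains m where "monic C m" "Cod C m = prod_ob C X X" "R = sub_class C m"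
  using assms unfolding rels_def subobjects_def by blast

lemma rels_member:
  assumes "R \<in> rels C X" "r \<in> R"
  shows "monic C r" "r \<in> Arr C" "Cod C r = prod_ob C X X"
proof -
  from assms(1) obtain m where m: "monic C m" "Cod C m = prod_ob C X X" "R = sub_class C m"
    by (rule relsE)
  note [simp] = m(2) monic_Arr[OF m(1)]
  from assms(2) m(3) obtain i where i: "monic C r" "isomorphism C i" "Cod C i = Dom C m" "m \<cdot> i = r"
    unfolding sub_class_def by blast
  then have "i \<in> Arr C"
    unfolding isomorphism_def by blast
  then have "Cod C (m \<cdot> i) = prod_ob C X X"
    using i(3) by simp
  then have "Cod C r = prod_ob C X X"
    unfolding i(4) .
  with i show "monic C r" "r \<in> Arr C" "Cod C r = prod_ob C X X"
    by (simp_all add: monic_Arr)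
qed

lemma rels_nonempty:
  assumes "R \<in> rels C X"
  obtains r where "r \<in> R"
  using relsE[OF assms] sub_class_self by blast

lemma rels_comp_iso:
  assumes R: "R \<in> rels C X" and r: "r \<in> R" and i: "isomorphism C i" "Cod C i = Dom C r"
  shows "r \<cdot> i \<in> R"
proof -
  from R obtain m where m: "monic C m" "Cod C m = prod_ob C X X" "R = sub_class C m"
    by (rule relsE)
  note [simp] = monic_Arr[OF m(1)]
  from r m(3) obtain j where j: "monic C r" "isomorphism C j" "Dom C j = Dom C r" "Cod C j = Dom C m"
    "m \<cdot> j = r"
    unfolding sub_class_def by blast
  have [simp]: "i \<in> Arr C" "j \<in> Arr C"
    using i j unfolding isomorphism_def by blast+
  have "isomorphism C (j \<cdot> i)"
    by (rule isomorphism_comp) (use i j in simp_all)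
  moreover have "monic C (r \<cdot> i)"
    by (rule monic_comp_iso) (use i j in simp_all)
  moreover have "m \<cdot> (j \<cdot> i) = r \<cdot> i"
    by (rule Comp_eq_extend_single[OF j(5)]) (use i j in simp_all)
  moreover have "Dom C (j \<cdot> i) = Dom C (r \<cdot> i)" "Cod C (j \<cdot> i) = Dom C m"
    using i j by (simp_all add: monic_Arr)
  ultimately show ?thesis
    unfolding m(3) sub_class_def by blast
qed

lemma rels_compare:
  assumes "R \<in> rels C X" "r \<in> R" "s \<in> R"
  obtains h where "h \<in> Arr C" "Dom C h = Dom C r" "Cod C h = Dom C s" "s \<cdot> h = r"
proof -
  from assms(1) obtain m where m: "monic C m" "Cod C m = prod_ob C X X" "R = sub_class C m"
    by (rule relsE)
  note [simp] = monic_Arr[OF m(1)]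
  from assms(2) m(3) obtain i where i: "isomorphism C i" "Dom C i = Dom C r" "Cod C i = Dom C m"
    "m \<cdot> i = r"
    unfolding sub_class_def by blast
  from assms(3) m(3) obtain j where j: "isomorphism C j" "Dom C j = Dom C s" "Cod C j = Dom C m"
    "m \<cdot> j = s"
    unfolding sub_class_def by blast
  from j(1) obtain j' where j': "j \<in> Arr C" "j' \<in> Arr C" "Dom C j' = Cod C j" "Cod C j' = Dom C j"
    "j \<cdot> j' = Ident C (Cod C j)"
    by (rule isomorphismE)
  have [simp]: "i \<in> Arr C"
    using i unfolding isomorphism_def by blast
  have "m \<cdot> (j \<cdot> j') = s \<cdot> j'"
    by (rule Comp_eq_extend_single[OF j(4)]) (use j(3) j' in simp_all)
  then have "s \<cdot> j' = m"
    using j(3) j'(5) by simp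
  then have "s \<cdot> (j' \<cdot> i) = m \<cdot> i"
    by (rule Comp_eq_extend_single) (use i j j' rels_member[OF assms(1,3)] in simp_all)
  then show ?thesis
    by (intro that[of "j' \<cdot> i"]) (use i j j' in simp_all)
qed

text \<open>Membership can be tested on any representative, as all of them factor through one another.\<close>

lemma related_iff_factors:
  assumes "X \<in> Ob C" "R \<in> rels C X" "r \<in> R"
  shows "related C X R a b \<longleftrightarrow> factors C X r a b"
proof
  assume "related C X R a b"
  then obtain s where s: "s \<in> R" "factors C X s a b"
    unfolding related_def by blast
  obtain h where "h \<in> Arr C" "Dom C h = Dom C s" "Cod C h = Dom C r" "r \<cdot> h = s"
    using rels_compare[OF assms(2) s(1) assms(3)] .
  then show "factors C X r a b"
    by (rule factors_mono[OF assms(1) rels_member(2)[OF assms(2) s(1)] rels_member(2,3)[OF assms(2,3)]])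
      (rule s(2))
next
  show "factors C X r a b \<Longrightarrow> related C X R a b"
    using assms(3) unfolding related_def by blast
qed

lemma related_parallel:
  assumes "X \<in> Ob C" "R \<in> rels C X" "related C X R a b"
  shows "parallel C X a b"
  using assms(3) factors_parallel[OF assms(1)] rels_member(2,3)[OF assms(2)]
  unfolding related_def by blast

lemma related_comp:
  assumes "X \<in> Ob C" "R \<in> rels C X" "related C X R a b" "g \<in> Arr C" "Cod C g = Dom C a"
  shows "related C X R (a \<cdot> g) (b \<cdot> g)"
  using assms(3) factors_comp[OF assms(1) _ _ _ assms(4,5)] rels_member(2,3)[OF assms(2)]
  unfolding related_def by blast

lemma related_descent:
  assumes "X \<in> Ob C" "R \<in> rels C X" "regular_epi C e" "parallel C X a b" "Cod C e = Dom C a"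
    "related C X R (a \<cdot> e) (b \<cdot> e)"
  shows "related C X R a b"
  using assms(6) factors_descent[OF assms(1,3) _ _ assms(4,5)] rels_member(1,3)[OF assms(2)]
  unfolding related_def by blast

lemma sub_le_iff:
  assumes X: "X \<in> Ob C" and R: "R \<in> rels C X" and S: "S \<in> rels C X"
  shows "sub_le C R S \<longleftrightarrow> (\<forall>a b. related C X R a b \<longrightarrow> related C X S a b)"
proof
  assume "sub_le C R S"
  then obtain r s h where rs: "r \<in> R" "s \<in> S"
    and h: "h \<in> Arr C" "Dom C h = Dom C r" "Cod C h = Dom C s" "s \<cdot> h = r"
    unfolding sub_le_def hom_set_def by blast
  show "\<forall>a b. related C X R a b \<longrightarrow> related C X S a b"
    unfolding related_iff_factors[OF X R rs(1)] related_iff_factors[OF X S rs(2)]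
    using factors_mono[OF X rels_member(2)[OF R rs(1)] rels_member(2,3)[OF S rs(2)] h] by blast
next
  assume le: "\<forall>a b. related C X R a b \<longrightarrow> related C X S a b"
  obtain r where "r \<in> R"
    by (rule rels_nonempty[OF R])
  moreover obtain s where "s \<in> S"
    by (rule rels_nonempty[OF S])
  ultimately have rs: "r \<in> R" "s \<in> S" .
  have "factors C X s (pr1 C X X \<cdot> r) (pr2 C X X \<cdot> r)"
    using le factors_projections[OF X rels_member(2,3)[OF R rs(1)]]
    unfolding related_iff_factors[OF X R rs(1)] related_iff_factors[OF X S rs(2)] by blast
  then show "sub_le C R S"
    unfolding sub_le_def hom_set_def
      factors_projections_iff[OF X rels_member(2)[OF R rs(1)] rels_member(2)[OF S rs(2)]
        rels_member(3)[OF R rs(1)] rels_member(3)[OF S rs(2)]]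
    using rs by blast
qed

lemma factors_equiv_iso:
  assumes X: "X \<in> Ob C" and m: "monic C m" "Cod C m = prod_ob C X X"
    and n: "monic C n" "Cod C n = prod_ob C X X"
    and eq: "\<And>a b. factors C X m a b \<longleftrightarrow> factors C X n a b"
  obtains i where "isomorphism C i" "Dom C i = Dom C n" "Cod C i = Dom C m" "m \<cdot> i = n"
proof -
  note arr = monic_Arr[OF m(1)] monic_Arr[OF n(1)]
  obtain h where h: "h \<in> Arr C" "Dom C h = Dom C n" "Cod C h = Dom C m" "m \<cdot> h = n"
    using factors_projections[OF X arr(2) n(2)] eq
      factors_projections_iff[OF X arr(2,1) n(2) m(2)] by blast
  obtain k where k: "k \<in> Arr C" "Dom C k = Dom C m" "Cod C k = Dom C n" "n \<cdot> k = m"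
    using factors_projections[OF X arr(1) m(2)] eq
      factors_projections_iff[OF X arr(1,2) m(2) n(2)] by blast
  show ?thesis
    by (rule that[OF mutual_factor_isomorphism[OF m(1) n(1) h k] h(2-4)])
qed

text \<open>Equality of relations is equality of classes of arrows. The universal pairs of two
  representatives give mutually inverse comparisons, so each is isomorphic to a member of the other class.\<close>

lemma rel_eqI:
  assumes X: "X \<in> Ob C" and R: "R \<in> rels C X" and S: "S \<in> rels C X"
    and eq: "\<And>a b. related C X R a b \<longleftrightarrow> related C X S a b"
  shows "R = S"
proof -
  have "R' \<subseteq> S'" if R': "R' \<in> rels C X" and S': "S' \<in> rels C X"
    and eq': "\<And>a b. related C X R' a b \<longleftrightarrow> related C X S' a b" for R' S'
  proof
    fix r
    assume r: "r \<in> R'"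
    obtain s where s: "s \<in> S'"
      using rels_nonempty[OF S'] .
    have "factors C X s a b \<longleftrightarrow> factors C X r a b" for a b
      using eq' unfolding related_iff_factors[OF X R' r] related_iff_factors[OF X S' s] by blast
    then obtain i where "isomorphism C i" "Cod C i = Dom C s" "s \<cdot> i = r"
      using factors_equiv_iso[OF X rels_member(1,3)[OF S' s] rels_member(1,3)[OF R' r]] by blast
    then show "r \<in> S'"
      using rels_comp_iso[OF S' s] by blast
  qed
  from this[OF R S eq] this[OF S R eq[symmetric]] show ?thesis
    by blast
qed

text \<open>The operations on relations are defined by collecting results over all choices of
  representatives, pullbacks and factorizations. Such a collection is one isomorphism class as soon as
  its members have the same generalized elements; the predicate \<open>P\<close> that describes these elements is
  then the meaning of the operation.\<close>

lemma rels_by_factors: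
  assumes X: "X \<in> Ob C" and ne: "m0 \<in> K"
    and mono: "\<And>m. m \<in> K \<Longrightarrow> monic C m" "\<And>m. m \<in> K \<Longrightarrow> Cod C m = prod_ob C X X"
    and iso: "\<And>m i. m \<in> K \<Longrightarrow> isomorphism C i \<Longrightarrow> Cod C i = Dom C m \<Longrightarrow> m \<cdot> i \<in> K"
    and P: "\<And>m a b. m \<in> K \<Longrightarrow> factors C X m a b \<longleftrightarrow> P a b"
  shows "K \<in> rels C X" and "related C X K a b \<longleftrightarrow> P a b"
proof -
  have "K = sub_class C m0"
  proof (intro equalityI subsetI)
    fix n
    assume n: "n \<in> K"
    obtain i where "isomorphism C i" "Dom C i = Dom C n" "Cod C i = Dom C m0" "m0 \<cdot> i = n"
      by (rule factors_equiv_iso[OF X mono[OF ne] mono[OF n]]) (use P[OF n] P[OF ne] in blast)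
    then show "n \<in> sub_class C m0"
      unfolding sub_class_def using mono(1)[OF n] by blast
  next
    fix n
    assume "n \<in> sub_class C m0"
    then show "n \<in> K"
      unfolding sub_class_def using iso[OF ne] by blast
  qed
  then show "K \<in> rels C X"
    unfolding rels_def subobjects_def using mono[OF ne] by blast
  show "related C X K a b \<longleftrightarrow> P a b"
    unfolding related_def using P ne by blast
qed

end

section \<open>Operations on relations in terms of elements\<close>

context category
begin

lemma imgE:
  assumes "m \<in> img C g"
  obtains e where "monic C m" "regular_epi C e" "Cod C e = Dom C m" "m \<cdot> e = g"
    "g \<in> Arr C" "Dom C e = Dom C g" "Cod C m = Cod C g"
proof -
  obtain e where e: "monic C m" "regular_epi C e" "Cod C e = Dom C m" "m \<cdot> e = g"
    using assms unfolding img_def by blast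
  note arr = monic_Arr[OF e(1)] regular_epi_Arr[OF e(2)]
  have "m \<cdot> e \<in> Arr C" "Dom C e = Dom C (m \<cdot> e)" "Cod C m = Cod C (m \<cdot> e)"
    using arr e(3) by simp_all
  then show ?thesis
    unfolding e(4) by (rule that[OF e])
qed

lemma img_comp_iso:
  assumes "m \<in> img C g" and i: "isomorphism C i" "Cod C i = Dom C m"
  shows "m \<cdot> i \<in> img C g"
proof -
  obtain e where e: "monic C m" "regular_epi C e" "Cod C e = Dom C m" "m \<cdot> e = g"
    using assms(1) unfolding img_def by blast
  from i(1) obtain j where j: "i \<in> Arr C" "j \<in> Arr C" "Dom C j = Cod C i" "Cod C j = Dom C i"
    "j \<cdot> i = Ident C (Dom C i)" "i \<cdot> j = Ident C (Cod C i)"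
    by (rule isomorphismE)
  note [simp] = monic_Arr[OF e(1)] regular_epi_Arr[OF e(2)] e(3) i(2) j(1-4)
  have "isomorphism C j"
    by (rule isomorphismI[of j i]) (use j(5,6) in simp_all)
  then have "regular_epi C (j \<cdot> e)"
    by (rule iso_comp_regular_epi[OF e(2)]) simp
  moreover have "i \<cdot> (j \<cdot> e) = e"
    using Comp_eq_extend_single[OF j(6), of e] by simp
  then have "(m \<cdot> i) \<cdot> (j \<cdot> e) = g"
    using e(4) by simp
  moreover have "Cod C (j \<cdot> e) = Dom C (m \<cdot> i)"
    by simp
  ultimately show ?thesis
    using monic_comp_iso[OF e(1) i] unfolding img_def by blast
qed

end

context regular_category
begin

lemma img_nonempty:
  assumes "g \<in> Arr C"
  obtains m where "m \<in> img C g"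
proof -
  obtain e m where "regular_epi C e" "monic C m" "Cod C e = Dom C m" "m \<cdot> e = g"
    using regular_epi_mono_factorization[OF assms] by metis
  then have "m \<in> img C g"
    unfolding img_def by blast
  then show ?thesis
    by (rule that)
qed

text \<open>Pulling the regular epimorphism of the factorization back along a witness for \<open>m\<close> gives
  the cover on which a witness for \<open>g\<close> exists; conversely membership in \<open>m\<close> descends along the cover.\<close>

lemma factors_img_iff:
  assumes X: "X \<in> Ob C" and m: "m \<in> img C g" and g: "Cod C g = prod_ob C X X"
  shows "factors C X m a b \<longleftrightarrow> parallel C X a b \<and>
    (\<exists>e. regular_epi C e \<and> Cod C e = Dom C a \<and> factors C X g (a \<cdot> e) (b \<cdot> e))"
proof
  from m obtain d where d: "monic C m" "regular_epi C d" "Cod C d = Dom C m" "m \<cdot> d = g"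
    "g \<in> Arr C" "Dom C d = Dom C g" "Cod C m = Cod C g"
    by (rule imgE)
  note [simp] = X g monic_Arr[OF d(1)] regular_epi_Arr[OF d(2)] d(3,5-7)
  {
    assume f: "factors C X m a b"
    have par: "parallel C X a b"
      by (rule factors_parallel[OF X _ _ f]) simp_all
    note [simp] = parallelD[OF par]
    from f obtain h where [simp]: "h \<in> Arr C" "Dom C h = Dom C a" "Cod C h = Dom C m"
      and h: "pr1 C X X \<cdot> (m \<cdot> h) = a" "pr2 C X X \<cdot> (m \<cdot> h) = b"
      by (rule factorsE)
    obtain p q where pb: "is_pullback C d h p q"
      using ex_pullback[of d h] by auto
    note [simp] = pullbackD(3,4,6-8)[OF pb]
    have "m \<cdot> (h \<cdot> q) = g \<cdot> p"
      using Comp_eq_extend_single[OF d(4), of p] pullbackD(9)[OF pb] by simp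
    moreover have "pr1 C X X \<cdot> ((m \<cdot> h) \<cdot> q) = a \<cdot> q" "pr2 C X X \<cdot> ((m \<cdot> h) \<cdot> q) = b \<cdot> q"
      by (rule Comp_eq_extend_single; simp add: h)+
    ultimately have "factors C X g (a \<cdot> q) (b \<cdot> q)"
      by (intro factorsI[of p]) simp_all
    moreover have "regular_epi C q"
      using regular_epi_stable[OF pb d(2)] .
    ultimately show "parallel C X a b \<and>
        (\<exists>e. regular_epi C e \<and> Cod C e = Dom C a \<and> factors C X g (a \<cdot> e) (b \<cdot> e))"
      using par by (intro conjI exI[of _ q]) simp_all
  }
  {
    assume "parallel C X a b \<and>
      (\<exists>e. regular_epi C e \<and> Cod C e = Dom C a \<and> factors C X g (a \<cdot> e) (b \<cdot> e))"
    then obtain e where par: "parallel C X a b" and e: "regular_epi C e" "Cod C e = Dom C a"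
      and f: "factors C X g (a \<cdot> e) (b \<cdot> e)"
      by blast
    have "factors C X m (a \<cdot> e) (b \<cdot> e)"
      by (rule factors_mono[OF X d(5) _ _ _ _ _ d(4) f]) simp_all
    then show "factors C X m a b"
      by (intro factors_descent[OF X e(1) d(1) _ par e(2)]) simp_all
  }
qed

text \<open>The common shape of composites and direct images: existence becomes existence after
  passing to a regular epimorphism.\<close>

lemma rels_of_images:
  assumes X: "X \<in> Ob C" and ne: "g0 \<in> G"
    and G: "\<And>g. g \<in> G \<Longrightarrow> g \<in> Arr C" "\<And>g. g \<in> G \<Longrightarrow> Cod C g = prod_ob C X X"
    and Q: "\<And>g a b. g \<in> G \<Longrightarrow> factors C X g a b \<longleftrightarrow> Q a b"
    and K: "K = {m. \<exists>g \<in> G. m \<in> img C g}"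
  shows "K \<in> rels C X"
    and "related C X K a b \<longleftrightarrow> parallel C X a b \<and>
      (\<exists>e. regular_epi C e \<and> Cod C e = Dom C a \<and> Q (a \<cdot> e) (b \<cdot> e))"
proof -
  obtain m0 where "m0 \<in> img C g0"
    using img_nonempty[OF G(1)[OF ne]] .
  then have m0: "m0 \<in> K"
    unfolding K using ne by blast
  have 1: "monic C m" "Cod C m = prod_ob C X X" if "m \<in> K" for m
  proof -
    obtain g where "g \<in> G" "m \<in> img C g"
      using \<open>m \<in> K\<close> K by blast
    then show "monic C m" "Cod C m = prod_ob C X X"
      using imgE[of m g] G(2)[of g] by metis+
  qed
  have 2: "m \<cdot> i \<in> K" if "m \<in> K" "isomorphism C i" "Cod C i = Dom C m" for m i
    using that img_comp_iso unfolding K by blast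
  have 3: "factors C X m a b \<longleftrightarrow> parallel C X a b \<and>
      (\<exists>e. regular_epi C e \<and> Cod C e = Dom C a \<and> Q (a \<cdot> e) (b \<cdot> e))" if "m \<in> K" for m a b
  proof -
    obtain g where g: "g \<in> G" "m \<in> img C g"
      using \<open>m \<in> K\<close> K by blast
    show ?thesis
      unfolding factors_img_iff[OF X g(2) G(2)[OF g(1)]] Q[OF g(1)] ..
  qed
  show "K \<in> rels C X"
    by (rule rels_by_factors(1)[OF X m0 1 2 3])
  show "related C X K a b \<longleftrightarrow> parallel C X a b \<and>
      (\<exists>e. regular_epi C e \<and> Cod C e = Dom C a \<and> Q (a \<cdot> e) (b \<cdot> e))"
    by (rule rels_by_factors(2)[OF X m0 1 2 3])
qed

lemma diag_rels_related:
  assumes [simp]: "X \<in> Ob C"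
  shows diag_rels: "diag C X \<in> rels C X"
    and related_diag_iff: "related C X (diag C X) a b \<longleftrightarrow> a \<in> Arr C \<and> Cod C a = X \<and> b = a"
proof -
  let ?d = "pairing C (Ident C X) (Ident C X)"
  have m: "monic C ?d"
    unfolding monic_def
  proof (intro conjI ballI impI)
    fix u v
    assume [simp]: "u \<in> Arr C" "v \<in> Arr C"
      and uv: "Dom C u = Dom C v \<and> Cod C u = Dom C ?d \<and> Cod C v = Dom C ?d \<and> ?d \<cdot> u = ?d \<cdot> v"
    have "Cod C u = Dom C ?d" "Cod C v = Dom C ?d"
      using uv by blast+
    then have [simp]: "Cod C u = X" "Cod C v = X"
      by simp_all
    have "pr1 C X X \<cdot> (?d \<cdot> u) = pr1 C X X \<cdot> (?d \<cdot> v)"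
      using uv by metis
    then show "u = v"
      by simp
  qed simp
  show R: "diag C X \<in> rels C X"
    unfolding diag_def rels_def subobjects_def using m
    by (intro CollectI exI[of _ ?d]) simp
  have "?d \<in> diag C X"
    unfolding diag_def by (rule sub_class_self[OF m])
  then have "related C X (diag C X) a b \<longleftrightarrow> factors C X ?d a b"
    by (rule related_iff_factors[OF assms R])
  also have "\<dots> \<longleftrightarrow> a \<in> Arr C \<and> Cod C a = X \<and> b = a"
  proof
    assume "factors C X ?d a b"
    then obtain h where h: "h \<in> Arr C" "Dom C h = Dom C a" "Cod C h = Dom C ?d"
      "pr1 C X X \<cdot> (?d \<cdot> h) = a" "pr2 C X X \<cdot> (?d \<cdot> h) = b"
      by (rule factorsE)
    then have "Cod C h = X"
      by simp
    then have "h = a" "h = b"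
      using h(1,4,5) by simp_all
    then show "a \<in> Arr C \<and> Cod C a = X \<and> b = a"
      using \<open>Cod C h = X\<close> h(1) by blast
  next
    assume "a \<in> Arr C \<and> Cod C a = X \<and> b = a"
    then show "factors C X ?d a b"
      by (intro factorsI[of a]) simp_all
  qed
  finally show "related C X (diag C X) a b \<longleftrightarrow> a \<in> Arr C \<and> Cod C a = X \<and> b = a" .
qed

lemma op_rels_related:
  assumes X: "X \<in> Ob C" and R: "R \<in> rels C X"
  shows op_rels: "rel_op C X R \<in> rels C X"
    and related_op_iff: "related C X (rel_op C X R) a b \<longleftrightarrow> related C X R b a"
proof -
  let ?t = "\<lambda>r. pairing C (pr2 C X X \<cdot> r) (pr1 C X X \<cdot> r)"
  have K: "rel_op C X R = ?t ` R"
    unfolding rel_op_def by blast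
  note [simp] = X
  have arr [simp]: "r \<in> Arr C" "Cod C r = prod_ob C X X" if "r \<in> R" for r
    using rels_member[OF R that] by blast+
  have mono: "monic C (?t r)" if r: "r \<in> R" for r
    unfolding monic_def
  proof (intro conjI ballI impI)
    note [simp] = r
    fix u v
    assume [simp]: "u \<in> Arr C" "v \<in> Arr C"
      and uv: "Dom C u = Dom C v \<and> Cod C u = Dom C (?t r) \<and> Cod C v = Dom C (?t r) \<and>
        ?t r \<cdot> u = ?t r \<cdot> v"
    have "Cod C u = Dom C (?t r)" "Cod C v = Dom C (?t r)" and [simp]: "Dom C v = Dom C u"
      using uv by metis+
    then have [simp]: "Cod C u = Dom C r" "Cod C v = Dom C r"
      by simp_all
    have "pr1 C X X \<cdot> (?t r \<cdot> u) = pr1 C X X \<cdot> (?t r \<cdot> v)" "pr2 C X X \<cdot> (?t r \<cdot> u) = pr2 C X X \<cdot> (?t r \<cdot> v)"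
      using uv by metis+
    then have "r \<cdot> u = r \<cdot> v"
      by (intro pr_jointly_monic[of X X "r \<cdot> u"]) simp_all
    then show "u = v"
      by (rule monic_cancel[OF rels_member(1)[OF R r]]) simp_all
  qed (use r in simp)
  have imp: "factors C X (?t r) b a" if r: "r \<in> R" and f: "factors C X r a b" for r a b
  proof -
    note [simp] = r parallelD[OF factors_parallel[OF X _ _ f]]
    from f obtain h where "h \<in> Arr C" "Dom C h = Dom C a" "Cod C h = Dom C r"
      "pr1 C X X \<cdot> (r \<cdot> h) = a" "pr2 C X X \<cdot> (r \<cdot> h) = b"
      by (rule factorsE)
    then show ?thesis
      by (intro factorsI[of h]) simp_all
  qed
  have imp': "factors C X r b a" if r: "r \<in> R" and f: "factors C X (?t r) a b" for r a b
  proof -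
    note [simp] = r
    have par [simp]: "parallel C X a b"
      by (rule factors_parallel[OF X _ _ f]) simp_all
    note [simp] = parallelD[OF par]
    from f obtain h where h: "h \<in> Arr C" "Dom C h = Dom C a" "Cod C h = Dom C (?t r)"
      "pr1 C X X \<cdot> (?t r \<cdot> h) = a" "pr2 C X X \<cdot> (?t r \<cdot> h) = b"
      by (rule factorsE)
    have "Cod C h = Dom C r"
      using h(3) by simp
    then show ?thesis
      using h(1,2,4,5) by (intro factorsI[of h]) simp_all
  qed
  obtain r0 where r0: "r0 \<in> R"
    by (rule rels_nonempty[OF R])
  have ne: "?t r0 \<in> rel_op C X R"
    unfolding K using r0 by blast
  have 1: "monic C m" if "m \<in> rel_op C X R" for m
    using that mono unfolding K by blast
  have 2: "Cod C m = prod_ob C X X" if "m \<in> rel_op C X R" for m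
    using that unfolding K by auto
  have 3: "m \<cdot> i \<in> rel_op C X R" if m: "m \<in> rel_op C X R" and i: "isomorphism C i" "Cod C i = Dom C m" for m i
  proof -
    obtain r where r: "r \<in> R" "m = ?t r"
      using m K by blast
    note [simp] = r(1) isomorphism_Arr[OF i(1)]
    have [simp]: "Cod C i = Dom C r"
      using i(2) r(2) by simp
    have "r \<cdot> i \<in> R"
      by (rule rels_comp_iso[OF R r(1) i(1)]) simp
    moreover have "m \<cdot> i = ?t (r \<cdot> i)"
      unfolding r(2) by (rule pr_jointly_monic[of X X]) simp_all
    ultimately show ?thesis
      unfolding K by blast
  qed
  have 4: "factors C X m a b \<longleftrightarrow> related C X R b a" if m: "m \<in> rel_op C X R" for m a b
  proof -
    obtain r where r: "r \<in> R" "m = ?t r"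
      using m K by blast
    show ?thesis
      unfolding r(2) related_iff_factors[OF X R r(1)] using imp[OF r(1)] imp'[OF r(1)] by blast
  qed
  show "rel_op C X R \<in> rels C X"
    by (rule rels_by_factors(1)[OF X ne 1 2 3 4])
  show "related C X (rel_op C X R) a b \<longleftrightarrow> related C X R b a"
    by (rule rels_by_factors(2)[OF X ne 1 2 3 4])
qed

end

context regular_category
begin

text \<open>Inverse images are pointwise, by the universal property of the pullback.\<close>

lemma inv_img_rels_related:
  assumes f [simp]: "f \<in> Arr C" "Dom C f = X" "Cod C f = Y" and S: "S \<in> rels C Y"
  shows inv_img_rels: "inv_img C f S \<in> rels C X"
    and related_inv_img_iff: "related C X (inv_img C f S) a b \<longleftrightarrow>
      parallel C X a b \<and> related C Y S (f \<cdot> a) (f \<cdot> b)"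
proof -
  have X [simp]: "X \<in> Ob C" and Y [simp]: "Y \<in> Ob C"
    using f Dom_Ob[of f] Cod_Ob[of f] by simp_all
  let ?F = "prod_arr C f f"
  have pbD: "monic C m" "Cod C m = prod_ob C X X" "s \<in> Arr C" "Cod C s = prod_ob C Y Y"
    if s: "s \<in> S" and pb: "is_pullback C ?F s m g" for s m g
  proof -
    note [simp] = rels_member(2,3)[OF S s] pullbackD(3,4,6)[OF pb]
    show C [simp]: "Cod C m = prod_ob C X X"
      using pullbackD(7)[OF pb] by simp
    have [simp]: "Cod C g = Dom C s"
      using pullbackD(8)[OF pb] .
    show "s \<in> Arr C" "Cod C s = prod_ob C Y Y"
      by simp_all
    show "monic C m"
      unfolding monic_def
    proof (intro conjI ballI impI)
      fix u v
      assume [simp]: "u \<in> Arr C" "v \<in> Arr C"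
        and uv: "Dom C u = Dom C v \<and> Cod C u = Dom C m \<and> Cod C v = Dom C m \<and> m \<cdot> u = m \<cdot> v"
      then have [simp]: "Cod C u = Dom C m" "Cod C v = Dom C m" "Dom C v = Dom C u"
        and eq: "m \<cdot> u = m \<cdot> v"
        by metis+
      have "?F \<cdot> (m \<cdot> u) = s \<cdot> (g \<cdot> u)" "?F \<cdot> (m \<cdot> v) = s \<cdot> (g \<cdot> v)"
        by (rule Comp_eq_extend[OF pullbackD(9)[OF pb]]; simp)+
      then have "s \<cdot> (g \<cdot> u) = s \<cdot> (g \<cdot> v)"
        using eq by metis
      then have "g \<cdot> u = g \<cdot> v"
        by (rule monic_cancel[OF rels_member(1)[OF S s]]) simp_all
      with eq show "u = v"
        by (intro pullback_cancel[OF pb, of u v]) simp_all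
    qed simp
  qed
  obtain s0 where s0: "s0 \<in> S"
    by (rule rels_nonempty[OF S])
  obtain m0 g0 where "is_pullback C ?F s0 m0 g0"
    using ex_pullback[of ?F s0] rels_member(2,3)[OF S s0] by auto
  then have ne: "m0 \<in> inv_img C f S"
    unfolding inv_img_def using s0 by blast
  have 1: "monic C m" if "m \<in> inv_img C f S" for m
    using that pbD(1) unfolding inv_img_def by blast
  have 2: "Cod C m = prod_ob C X X" if "m \<in> inv_img C f S" for m
    using that pbD(2) unfolding inv_img_def by blast
  have 3: "m \<cdot> i \<in> inv_img C f S"
    if m: "m \<in> inv_img C f S" and i: "isomorphism C i" "Cod C i = Dom C m" for m i
  proof -
    obtain s g where s: "s \<in> S" and pb: "is_pullback C ?F s m g"
      using m unfolding inv_img_def by blast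
    from i(1) obtain j where j: "i \<in> Arr C" "j \<in> Arr C" "Dom C j = Cod C i" "Cod C j = Dom C i"
      "j \<cdot> i = Ident C (Dom C i)" "i \<cdot> j = Ident C (Cod C i)"
      by (rule isomorphismE)
    note [simp] = rels_member(2,3)[OF S s] pullbackD(3,4,6,8)[OF pb] pbD(2)[OF s pb] i(2) j(1-4)
    have "is_pullback C ?F s (m \<cdot> i) (g \<cdot> i)"
      unfolding is_pullback_def
    proof (intro conjI ballI impI)
      show "?F \<cdot> (m \<cdot> i) = s \<cdot> (g \<cdot> i)"
        by (rule Comp_eq_extend[OF pullbackD(9)[OF pb]]) simp_all
    next
      fix a b
      assume [simp]: "a \<in> Arr C" "b \<in> Arr C" and ab: "Dom C a = Dom C b \<and> Cod C a = Dom C ?F \<and>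
        Cod C b = Dom C s \<and> ?F \<cdot> a = s \<cdot> b"
      have "\<exists>!h. h \<in> hom_set C (Dom C a) (Dom C m) \<and> m \<cdot> h = a \<and> g \<cdot> h = b"
        by (rule ex1_pullback_lift[OF pb]) (use ab \<open>a \<in> Arr C\<close> \<open>b \<in> Arr C\<close> in blast)+
      then obtain h where [simp]: "h \<in> Arr C" "Dom C h = Dom C a" "Cod C h = Dom C m"
        and h: "m \<cdot> h = a" "g \<cdot> h = b"
        unfolding hom_set_def by blast
      have ijh: "i \<cdot> (j \<cdot> h) = h"
        using Comp_eq_extend_single[OF j(6), of h] by simp
      show "\<exists>!k. k \<in> hom_set C (Dom C a) (Dom C (m \<cdot> i)) \<and> (m \<cdot> i) \<cdot> k = a \<and> (g \<cdot> i) \<cdot> k = b"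
      proof (rule ex1I[of _ "j \<cdot> h"])
        show "j \<cdot> h \<in> hom_set C (Dom C a) (Dom C (m \<cdot> i)) \<and> (m \<cdot> i) \<cdot> (j \<cdot> h) = a \<and>
            (g \<cdot> i) \<cdot> (j \<cdot> h) = b"
          using ijh h by (simp add: hom_set_def)
      next
        fix k
        assume k: "k \<in> hom_set C (Dom C a) (Dom C (m \<cdot> i)) \<and> (m \<cdot> i) \<cdot> k = a \<and> (g \<cdot> i) \<cdot> k = b"
        then have kk [simp]: "k \<in> Arr C" "Dom C k = Dom C a" "Cod C k = Dom C i"
          by (auto simp: hom_set_def)
        have "m \<cdot> (i \<cdot> k) = a" "g \<cdot> (i \<cdot> k) = b"
          using conjunct2[OF k] by simp_all
        then have "i \<cdot> k = h"
          by (intro pullback_cancel[OF pb, of "i \<cdot> k" h]) (simp_all add: h)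
        then have "j \<cdot> h = j \<cdot> (i \<cdot> k)"
          by simp
        also have "\<dots> = k"
          using Comp_eq_extend_single[OF j(5), of k] by simp
        finally show "k = j \<cdot> h" ..
      qed
    qed simp_all
    then show ?thesis
      unfolding inv_img_def using s by blast
  qed
  have 4: "factors C X m a b \<longleftrightarrow> parallel C X a b \<and> related C Y S (f \<cdot> a) (f \<cdot> b)"
    if m: "m \<in> inv_img C f S" for m a b
  proof -
    obtain s g where s: "s \<in> S" and pb: "is_pullback C ?F s m g"
      using m unfolding inv_img_def by blast
    note [simp] = rels_member(2,3)[OF S s] pullbackD(3,4,6,8)[OF pb] pbD(2)[OF s pb]
    note rel = related_iff_factors[OF Y S s]
    show ?thesis
    proof
      assume fm: "factors C X m a b"
      have par: "parallel C X a b"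
        by (rule factors_parallel[OF X _ _ fm]) simp_all
      note [simp] = parallelD[OF par]
      from fm obtain h where h: "h \<in> Arr C" "Dom C h = Dom C a" "Cod C h = Dom C m"
        "pr1 C X X \<cdot> (m \<cdot> h) = a" "pr2 C X X \<cdot> (m \<cdot> h) = b"
        by (rule factorsE)
      note [simp] = h(1-3)
      have eq: "s \<cdot> (g \<cdot> h) = ?F \<cdot> (m \<cdot> h)"
        by (rule Comp_eq_extend[OF pullbackD(9)[OF pb, symmetric]]) simp_all
      have "factors C Y s (f \<cdot> a) (f \<cdot> b)"
        by (rule factorsI[of "g \<cdot> h"]) (simp_all add: eq h(4,5))
      with par rel show "parallel C X a b \<and> related C Y S (f \<cdot> a) (f \<cdot> b)"
        by blast
    next
      assume "parallel C X a b \<and> related C Y S (f \<cdot> a) (f \<cdot> b)"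
      then have par: "parallel C X a b" and fs: "factors C Y s (f \<cdot> a) (f \<cdot> b)"
        using rel by blast+
      note [simp] = parallelD[OF par]
      from fs obtain k where k: "k \<in> Arr C" "Dom C k = Dom C (f \<cdot> a)" "Cod C k = Dom C s"
        "pr1 C Y Y \<cdot> (s \<cdot> k) = f \<cdot> a" "pr2 C Y Y \<cdot> (s \<cdot> k) = f \<cdot> b"
        by (rule factorsE)
      have "?F \<cdot> pairing C a b = s \<cdot> k"
        by (rule pr_jointly_monic[of Y Y]) (use k in simp_all)
      then have "\<exists>!h. h \<in> hom_set C (Dom C (pairing C a b)) (Dom C m) \<and> m \<cdot> h = pairing C a b \<and> g \<cdot> h = k"
        by (intro ex1_pullback_lift[OF pb]) (use k(1-3) in simp_all)
      then obtain h where h: "h \<in> Arr C" "Dom C h = Dom C (pairing C a b)" "Cod C h = Dom C m"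
        "m \<cdot> h = pairing C a b"
        unfolding hom_set_def by blast
      show "factors C X m a b"
        by (rule factorsI[of h]) (use h in simp_all)
    qed
  qed
  show "inv_img C f S \<in> rels C X"
    by (rule rels_by_factors(1)[OF X ne 1 2 3 4])
  show "related C X (inv_img C f S) a b \<longleftrightarrow> parallel C X a b \<and> related C Y S (f \<cdot> a) (f \<cdot> b)"
    by (rule rels_by_factors(2)[OF X ne 1 2 3 4])
qed

text \<open>The witnesses in \<open>X\<close> live only on a regular epimorphism over the domain of \<open>a\<close> and \<open>b\<close>.\<close>

lemma dir_img_rels_related:
  assumes f [simp]: "f \<in> Arr C" "Dom C f = X" "Cod C f = Y" and R: "R \<in> rels C X"
  shows dir_img_rels: "dir_img C f R \<in> rels C Y"
    and related_dir_img_iff: "related C Y (dir_img C f R) a b \<longleftrightarrow> parallel C Y a b \<and>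
      (\<exists>e. regular_epi C e \<and> Cod C e = Dom C a \<and>
        (\<exists>x y. related C X R x y \<and> f \<cdot> x = a \<cdot> e \<and> f \<cdot> y = b \<cdot> e))"
proof -
  have X [simp]: "X \<in> Ob C" and Y [simp]: "Y \<in> Ob C"
    using f Dom_Ob[of f] Cod_Ob[of f] by simp_all
  let ?F = "prod_arr C f f"
  let ?G = "(\<lambda>r. ?F \<cdot> r) ` R"
  have K: "dir_img C f R = {m. \<exists>g \<in> ?G. m \<in> img C g}"
    unfolding dir_img_def by blast
  obtain r0 where r0: "r0 \<in> R"
    by (rule rels_nonempty[OF R])
  then have ne: "?F \<cdot> r0 \<in> ?G"
    by blast
  have 1: "g \<in> Arr C" "Cod C g = prod_ob C Y Y" if "g \<in> ?G" for g
    using that rels_member(2,3)[OF R] by auto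
  have 2: "factors C Y g a b \<longleftrightarrow> (\<exists>x y. related C X R x y \<and> f \<cdot> x = a \<and> f \<cdot> y = b)"
    if g: "g \<in> ?G" for g a b
  proof -
    obtain r where r: "r \<in> R" "g = ?F \<cdot> r"
      using g by blast
    note [simp] = rels_member(2,3)[OF R r(1)]
    note rel = related_iff_factors[OF X R r(1)]
    show ?thesis
    proof
      assume "factors C Y g a b"
      then obtain h where h: "h \<in> Arr C" "Dom C h = Dom C a" "Cod C h = Dom C g"
        "pr1 C Y Y \<cdot> (g \<cdot> h) = a" "pr2 C Y Y \<cdot> (g \<cdot> h) = b"
        by (rule factorsE)
      have [simp]: "Cod C h = Dom C r"
        using h(3) r(2) by simp
      have "factors C X r (pr1 C X X \<cdot> (r \<cdot> h)) (pr2 C X X \<cdot> (r \<cdot> h))"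
        using h(1) by (intro factorsI[of h]) simp_all
      moreover have "f \<cdot> (pr1 C X X \<cdot> (r \<cdot> h)) = a" "f \<cdot> (pr2 C X X \<cdot> (r \<cdot> h)) = b"
        using h(1,4,5) r(2) by simp_all
      ultimately show "\<exists>x y. related C X R x y \<and> f \<cdot> x = a \<and> f \<cdot> y = b"
        using rel by blast
    next
      assume "\<exists>x y. related C X R x y \<and> f \<cdot> x = a \<and> f \<cdot> y = b"
      then obtain x y where fx: "factors C X r x y" and xy: "f \<cdot> x = a" "f \<cdot> y = b"
        using rel by blast
      have par: "parallel C X x y"
        by (rule factors_parallel[OF X _ _ fx]) simp_all
      note [simp] = parallelD[OF par]
      from fx obtain h where [simp]: "h \<in> Arr C" "Dom C h = Dom C x" "Cod C h = Dom C r"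
        and h: "pr1 C X X \<cdot> (r \<cdot> h) = x" "pr2 C X X \<cdot> (r \<cdot> h) = y"
        by (rule factorsE)
      show "factors C Y g a b"
        unfolding r(2) xy[symmetric] by (rule factorsI[of h]) (simp_all add: h)
    qed
  qed
  show "dir_img C f R \<in> rels C Y"
    by (rule rels_of_images(1)[OF Y ne 1 2 K])
  show "related C Y (dir_img C f R) a b \<longleftrightarrow> parallel C Y a b \<and>
      (\<exists>e. regular_epi C e \<and> Cod C e = Dom C a \<and>
        (\<exists>x y. related C X R x y \<and> f \<cdot> x = a \<cdot> e \<and> f \<cdot> y = b \<cdot> e))"
    by (rule rels_of_images(2)[OF Y ne 1 2 K])
qed

text \<open>The pullback in the definition of the composite classifies the triples \<open>(a, b, c)\<close> with
  \<open>a R b\<close> and \<open>b S c\<close>; taking the image quantifies \<open>b\<close> away locally.\<close>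

lemma comp_rels_related:
  assumes X [simp]: "X \<in> Ob C" and R: "R \<in> rels C X" and S: "S \<in> rels C X"
  shows comp_rels: "rel_comp C X S R \<in> rels C X"
    and related_comp_iff: "related C X (rel_comp C X S R) a c \<longleftrightarrow> parallel C X a c \<and>
      (\<exists>e. regular_epi C e \<and> Cod C e = Dom C a \<and>
        (\<exists>b. related C X R (a \<cdot> e) b \<and> related C X S b (c \<cdot> e)))"
proof -
  let ?g = "\<lambda>r s u v. pairing C ((pr1 C X X \<cdot> r) \<cdot> u) ((pr2 C X X \<cdot> s) \<cdot> v)"
  let ?G = "{?g r s u v | r s u v. r \<in> R \<and> s \<in> S \<and>
    is_pullback C (pr2 C X X \<cdot> r) (pr1 C X X \<cdot> s) u v}"
  have K: "rel_comp C X S R = {m. \<exists>g \<in> ?G. m \<in> img C g}"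
    unfolding rel_comp_def by blast
  note RD = rels_member(2,3)[OF R] and SD = rels_member(2,3)[OF S]
  obtain r0 where r0: "r0 \<in> R"
    by (rule rels_nonempty[OF R])
  obtain s0 where s0: "s0 \<in> S"
    by (rule rels_nonempty[OF S])
  have "\<exists>u v. is_pullback C (pr2 C X X \<cdot> r0) (pr1 C X X \<cdot> s0) u v"
    by (rule ex_pullback) (simp_all add: RD[OF r0] SD[OF s0])
  then obtain u0 v0 where "is_pullback C (pr2 C X X \<cdot> r0) (pr1 C X X \<cdot> s0) u0 v0"
    by blast
  then have ne: "?g r0 s0 u0 v0 \<in> ?G"
    using r0 s0 by blast
  have uvD: "u \<in> Arr C" "v \<in> Arr C" "Dom C v = Dom C u" "Cod C u = Dom C r" "Cod C v = Dom C s"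
    if "r \<in> R" "s \<in> S" "is_pullback C (pr2 C X X \<cdot> r) (pr1 C X X \<cdot> s) u v" for r s u v
    using pullbackD(3,4,6-8)[OF that(3)] RD[OF that(1)] SD[OF that(2)] by simp_all
  have 1: "g \<in> Arr C" "Cod C g = prod_ob C X X" if "g \<in> ?G" for g
  proof -
    obtain r s u v where g: "g = ?g r s u v" and rs: "r \<in> R" "s \<in> S"
      "is_pullback C (pr2 C X X \<cdot> r) (pr1 C X X \<cdot> s) u v"
      using \<open>g \<in> ?G\<close> by blast
    show "g \<in> Arr C" "Cod C g = prod_ob C X X"
      unfolding g using uvD[OF rs] RD[OF rs(1)] SD[OF rs(2)] by simp_all
  qed
  have 2: "factors C X g a c \<longleftrightarrow> (\<exists>b. related C X R a b \<and> related C X S b c)"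
    if "g \<in> ?G" for g a c
  proof -
    obtain r s u v where g: "g = ?g r s u v" and rs: "r \<in> R" "s \<in> S"
      and pb: "is_pullback C (pr2 C X X \<cdot> r) (pr1 C X X \<cdot> s) u v"
      using \<open>g \<in> ?G\<close> by blast
    note [simp] = RD[OF rs(1)] SD[OF rs(2)] uvD[OF rs pb]
    have [simp]: "Dom C g = Dom C u"
      unfolding g by simp
    note rel = related_iff_factors[OF X R rs(1)] related_iff_factors[OF X S rs(2)]
    show ?thesis
      unfolding rel
    proof
      assume "factors C X g a c"
      then obtain h where h: "h \<in> Arr C" "Dom C h = Dom C a" "Cod C h = Dom C g"
        "pr1 C X X \<cdot> (g \<cdot> h) = a" "pr2 C X X \<cdot> (g \<cdot> h) = c"
        by (rule factorsE)
      note [simp] = h(1,2)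
      have [simp]: "Cod C h = Dom C u"
        using h(3) by simp
      have a: "pr1 C X X \<cdot> (r \<cdot> (u \<cdot> h)) = a" and c: "pr2 C X X \<cdot> (s \<cdot> (v \<cdot> h)) = c"
        using h(4,5) unfolding g by simp_all
      have mid: "(pr2 C X X \<cdot> r) \<cdot> (u \<cdot> h) = (pr1 C X X \<cdot> s) \<cdot> (v \<cdot> h)"
        by (rule Comp_eq_extend[OF pullbackD(9)[OF pb]]) simp_all
      let ?b = "pr2 C X X \<cdot> (r \<cdot> (u \<cdot> h))"
      have "factors C X r a ?b"
        by (rule factorsI[of "u \<cdot> h"]) (simp_all add: a)
      moreover have "factors C X s ?b c"
        by (rule factorsI[of "v \<cdot> h"]) (use mid in \<open>simp_all add: c\<close>)
      ultimately show "\<exists>b. factors C X r a b \<and> factors C X s b c"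
        by blast
    next
      assume "\<exists>b. factors C X r a b \<and> factors C X s b c"
      then obtain b where fr: "factors C X r a b" and fs: "factors C X s b c"
        by blast
      have par: "parallel C X a b" "parallel C X b c"
        by (rule factors_parallel[OF X _ _ fr]; simp) (rule factors_parallel[OF X _ _ fs]; simp)
      note [simp] = parallelD[OF par(1)] parallelD(2,3,5)[OF par(2)]
      from fr obtain x where [simp]: "x \<in> Arr C" "Dom C x = Dom C a" "Cod C x = Dom C r"
        and x: "pr1 C X X \<cdot> (r \<cdot> x) = a" "pr2 C X X \<cdot> (r \<cdot> x) = b"
        by (rule factorsE)
      from fs obtain y where y': "y \<in> Arr C" "Dom C y = Dom C b" "Cod C y = Dom C s"
        and y: "pr1 C X X \<cdot> (s \<cdot> y) = b" "pr2 C X X \<cdot> (s \<cdot> y) = c"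
        by (rule factorsE)
      note [simp] = y'(1,3)
      have [simp]: "Dom C y = Dom C a"
        using y'(2) by simp
      have "\<exists>!h. h \<in> hom_set C (Dom C x) (Dom C u) \<and> u \<cdot> h = x \<and> v \<cdot> h = y"
        by (rule ex1_pullback_lift[OF pb]) (simp_all add: x y)
      then obtain h where [simp]: "h \<in> Arr C" "Dom C h = Dom C x" "Cod C h = Dom C u"
        and h: "u \<cdot> h = x" "v \<cdot> h = y"
        unfolding hom_set_def by blast
      show "factors C X g a c"
        unfolding g by (rule factorsI[of h]) (simp_all add: h x y)
    qed
  qed
  show "rel_comp C X S R \<in> rels C X"
    by (rule rels_of_images(1)[OF X ne 1 2 K])
  show "related C X (rel_comp C X S R) a c \<longleftrightarrow> parallel C X a c \<and>
      (\<exists>e. regular_epi C e \<and> Cod C e = Dom C a \<and>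
        (\<exists>b. related C X R (a \<cdot> e) b \<and> related C X S b (c \<cdot> e)))"
    by (rule rels_of_images(2)[OF X ne 1 2 K])
qed

lemma related_compI:
  assumes "X \<in> Ob C" "R \<in> rels C X" "S \<in> rels C X" "related C X R a b" "related C X S b c"
  shows "related C X (rel_comp C X S R) a c"
proof -
  have par: "parallel C X a b" "parallel C X b c"
    using related_parallel assms by blast+
  note D = parallelD[OF par(1)] parallelD(2,3,5)[OF par(2)]
  have "parallel C X a c"
    unfolding parallel_def using D by simp
  moreover have "regular_epi C (Ident C (Dom C a))" "Cod C (Ident C (Dom C a)) = Dom C a"
    using D by (simp_all add: regular_epi_Ident)
  moreover have "a \<cdot> Ident C (Dom C a) = a" "c \<cdot> Ident C (Dom C a) = c"
    using D by simp_all
  ultimately show ?thesis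
    unfolding related_comp_iff[OF assms(1-3)] using assms(4,5) by metis
qed

lemma related_compE:
  assumes "X \<in> Ob C" "R \<in> rels C X" "S \<in> rels C X" "related C X (rel_comp C X S R) a c"
  obtains e b where "parallel C X a c" "regular_epi C e" "Cod C e = Dom C a"
    "related C X R (a \<cdot> e) b" "related C X S b (c \<cdot> e)"
  using assms(4) unfolding related_comp_iff[OF assms(1-3)] by blast

end

section \<open>Composition of reflexive relations\<close>

context regular_category
begin

lemma rel_le_trans:
  "X \<in> Ob C \<Longrightarrow> R \<in> rels C X \<Longrightarrow> S \<in> rels C X \<Longrightarrow> T \<in> rels C X \<Longrightarrow>
    sub_le C R S \<Longrightarrow> sub_le C S T \<Longrightarrow> sub_le C R T"
  by (simp add: sub_le_iff)

text \<open>The local witness provided by a composite may be treated as a global one when the goal is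
  membership in a relation, because this descends.\<close>

lemma comp_leI:
  assumes X: "X \<in> Ob C" and R: "R \<in> rels C X" "S \<in> rels C X" "U \<in> rels C X"
    and le: "\<And>a b c. related C X R a b \<Longrightarrow> related C X S b c \<Longrightarrow> related C X U a c"
  shows "sub_le C (rel_comp C X S R) U"
  unfolding sub_le_iff[OF X comp_rels[OF X R(1,2)] R(3)]
proof (intro allI impI)
  fix a c
  assume "related C X (rel_comp C X S R) a c"
  then obtain e b where e: "parallel C X a c" "regular_epi C e" "Cod C e = Dom C a"
    and b: "related C X R (a \<cdot> e) b" "related C X S b (c \<cdot> e)"
    by (rule related_compE[OF X R(1,2)])
  show "related C X U a c"
    by (rule related_descent[OF X R(3) e(2,1,3) le[OF b]])
qed

lemma comp_mono_right:
  assumes X: "X \<in> Ob C" and R: "R \<in> rels C X" "R' \<in> rels C X" "S \<in> rels C X" and le: "sub_le C R R'"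
  shows "sub_le C (rel_comp C X S R) (rel_comp C X S R')"
  using le related_compI[OF X R(2,3)] unfolding sub_le_iff[OF X R(1,2)]
  by (intro comp_leI[OF X R(1,3) comp_rels[OF X R(2,3)]]) blast

lemma comp_diag:
  assumes X: "X \<in> Ob C" and R: "R \<in> rels C X"
  shows "rel_comp C X R (diag C X) = R"
proof (rule rel_eqI[OF X comp_rels[OF X diag_rels[OF X] R] R])
  fix a c
  have "sub_le C (rel_comp C X R (diag C X)) R"
    by (rule comp_leI[OF X diag_rels[OF X] R R]) (simp add: related_diag_iff[OF X])
  moreover have "related C X (rel_comp C X R (diag C X)) a c" if "related C X R a c"
  proof (rule related_compI[OF X diag_rels[OF X] R _ that])
    show "related C X (diag C X) a a"
      using parallelD[OF related_parallel[OF X R that]] by (simp add: related_diag_iff[OF X])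
  qed
  ultimately show "related C X (rel_comp C X R (diag C X)) a c \<longleftrightarrow> related C X R a c"
    using sub_le_iff[OF X comp_rels[OF X diag_rels[OF X] R] R] by blast
qed

lemma reflexive_rels_iff:
  assumes X: "X \<in> Ob C"
  shows "R \<in> reflexive_rels C X \<longleftrightarrow>
    R \<in> rels C X \<and> (\<forall>a. a \<in> Arr C \<and> Cod C a = X \<longrightarrow> related C X R a a)"
proof (cases "R \<in> rels C X")
  case True
  show ?thesis
    unfolding reflexive_rels_def using True
    by (auto simp: sub_le_iff[OF X diag_rels[OF X] True] related_diag_iff[OF X])
qed (simp add: reflexive_rels_def)

lemma preorder_rels_iff:
  assumes X: "X \<in> Ob C"
  shows "R \<in> preorder_rels C X \<longleftrightarrow> R \<in> reflexive_rels C X \<and>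
    (\<forall>a b c. related C X R a b \<and> related C X R b c \<longrightarrow> related C X R a c)"
proof (cases "R \<in> reflexive_rels C X")
  case True
  then have R: "R \<in> rels C X"
    unfolding reflexive_rels_def by blast
  have "sub_le C (rel_comp C X R R) R \<longleftrightarrow>
    (\<forall>a b c. related C X R a b \<and> related C X R b c \<longrightarrow> related C X R a c)"
  proof
    assume "sub_le C (rel_comp C X R R) R"
    then show "\<forall>a b c. related C X R a b \<and> related C X R b c \<longrightarrow> related C X R a c"
      unfolding sub_le_iff[OF X comp_rels[OF X R R] R] using related_compI[OF X R R] by blast
  next
    assume "\<forall>a b c. related C X R a b \<and> related C X R b c \<longrightarrow> related C X R a c"
    then show "sub_le C (rel_comp C X R R) R"
      by (intro comp_leI[OF X R R R]) blast
  qed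
  then show ?thesis
    unfolding preorder_rels_def using True by blast
qed (simp add: preorder_rels_def)

lemma equivalence_rels_iff:
  assumes X: "X \<in> Ob C"
  shows "R \<in> equivalence_rels C X \<longleftrightarrow> R \<in> preorder_rels C X \<and>
    (\<forall>a b. related C X R a b \<longrightarrow> related C X R b a)"
proof (cases "R \<in> preorder_rels C X")
  case True
  then have R: "R \<in> rels C X"
    unfolding preorder_rels_def reflexive_rels_def by blast
  show ?thesis
    unfolding equivalence_rels_def using True
    by (auto simp: sub_le_iff[OF X op_rels[OF X R] R] related_op_iff[OF X R])
qed (simp add: equivalence_rels_def)

lemma reflexive_relsD: "R \<in> reflexive_rels C X \<Longrightarrow> R \<in> rels C X"
  unfolding reflexive_rels_def by blast

lemma preorder_relsD: "R \<in> preorder_rels C X \<Longrightarrow> R \<in> reflexive_rels C X"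
  unfolding preorder_rels_def by blast

lemma equivalence_relsD: "R \<in> equivalence_rels C X \<Longrightarrow> R \<in> preorder_rels C X"
  unfolding equivalence_rels_def by blast

lemma diag_reflexive: "X \<in> Ob C \<Longrightarrow> diag C X \<in> reflexive_rels C X"
  by (simp add: reflexive_rels_iff diag_rels related_diag_iff)

lemma comp_reflexive:
  assumes X: "X \<in> Ob C" and R: "R \<in> reflexive_rels C X" "S \<in> reflexive_rels C X"
  shows "rel_comp C X S R \<in> reflexive_rels C X"
  using R related_compI[OF X] comp_rels[OF X] unfolding reflexive_rels_iff[OF X] by blast

lemma op_reflexive:
  assumes X: "X \<in> Ob C" and R: "R \<in> reflexive_rels C X"
  shows "rel_op C X R \<in> reflexive_rels C X"
  using R related_op_iff[OF X] op_rels[OF X] unfolding reflexive_rels_iff[OF X] by blast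

lemma le_comp_left:
  assumes X: "X \<in> Ob C" and R: "R \<in> reflexive_rels C X" and B: "B \<in> rels C X"
  shows "sub_le C B (rel_comp C X R B)"
  unfolding sub_le_iff[OF X B comp_rels[OF X B reflexive_relsD[OF R]]]
proof (intro allI impI)
  fix a b
  assume ab: "related C X B a b"
  have "related C X R b b"
    using R parallelD[OF related_parallel[OF X B ab]] unfolding reflexive_rels_iff[OF X] by blast
  then show "related C X (rel_comp C X R B) a b"
    by (rule related_compI[OF X B reflexive_relsD[OF R] ab])
qed

text \<open>Associativity of composition, in the one inclusion that an absorption argument uses:
  \<open>(R B) A \<subseteq> R (B A) \<subseteq> R U \<subseteq> U\<close>.\<close>

lemma comp_comp_le:
  assumes X: "X \<in> Ob C" and rels: "R \<in> rels C X" "B \<in> rels C X" "A \<in> rels C X" "U \<in> rels C X"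
    and BA: "sub_le C (rel_comp C X B A) U" and RU: "sub_le C (rel_comp C X R U) U"
  shows "sub_le C (rel_comp C X (rel_comp C X R B) A) U"
proof (rule comp_leI[OF X rels(3) comp_rels[OF X rels(2,1)] rels(4)])
  fix a b c
  assume ab: "related C X A a b" and bc: "related C X (rel_comp C X R B) b c"
  from bc obtain e d where e: "parallel C X b c" "regular_epi C e" "Cod C e = Dom C b"
    and d: "related C X B (b \<cdot> e) d" "related C X R d (c \<cdot> e)"
    by (rule related_compE[OF X rels(2,1)])
  have par: "parallel C X a b"
    by (rule related_parallel[OF X rels(3) ab])
  have ea: "Cod C e = Dom C a"
    using parallelD[OF par] e(3) by simp
  have "related C X A (a \<cdot> e) (b \<cdot> e)"
    by (rule related_comp[OF X rels(3) ab regular_epi_Arr[OF e(2)] ea])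
  then have "related C X (rel_comp C X B A) (a \<cdot> e) d"
    by (rule related_compI[OF X rels(3,2) _ d(1)])
  then have "related C X U (a \<cdot> e) d"
    using BA unfolding sub_le_iff[OF X comp_rels[OF X rels(3,2)] rels(4)] by blast
  then have "related C X (rel_comp C X R U) (a \<cdot> e) (c \<cdot> e)"
    by (rule related_compI[OF X rels(4,1) _ d(2)])
  then have "related C X U (a \<cdot> e) (c \<cdot> e)"
    using RU unfolding sub_le_iff[OF X comp_rels[OF X rels(4,1)] rels(4)] by blast
  moreover have "parallel C X a c"
    using parallelD[OF par] parallelD[OF e(1)] unfolding parallel_def by simp
  ultimately show "related C X U a c"
    by (intro related_descent[OF X rels(4) e(2) _ ea])
qed

lemma preorder_comp_absorb:
  assumes X: "X \<in> Ob C" and R: "R \<in> preorder_rels C X" and B: "B \<in> rels C X"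
  shows "sub_le C (rel_comp C X R (rel_comp C X R B)) (rel_comp C X R B)"
proof -
  have R': "R \<in> rels C X"
    using R preorder_relsD reflexive_relsD by blast
  show ?thesis
  proof (rule comp_leI[OF X comp_rels[OF X B R'] R' comp_rels[OF X B R']])
    fix a b c
    assume ab: "related C X (rel_comp C X R B) a b" and bc: "related C X R b c"
    from ab obtain e d where e: "parallel C X a b" "regular_epi C e" "Cod C e = Dom C a"
      and d: "related C X B (a \<cdot> e) d" "related C X R d (b \<cdot> e)"
      by (rule related_compE[OF X B R'])
    have eb: "Cod C e = Dom C b"
      using parallelD[OF e(1)] e(3) by simp
    have "related C X R (b \<cdot> e) (c \<cdot> e)"
      by (rule related_comp[OF X R' bc regular_epi_Arr[OF e(2)] eb])
    then have "related C X R d (c \<cdot> e)"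
      using R d(2) unfolding preorder_rels_iff[OF X] by blast
    then have "related C X (rel_comp C X R B) (a \<cdot> e) (c \<cdot> e)"
      by (rule related_compI[OF X B R' d(1)])
    moreover have "parallel C X a c"
      using parallelD[OF e(1)] parallelD[OF related_parallel[OF X R' bc]] unfolding parallel_def by simp
    ultimately show "related C X (rel_comp C X R B) a c"
      by (intro related_descent[OF X comp_rels[OF X B R'] e(2) _ e(3)])
  qed
qed

text \<open>The defining equations start the recursion at one factor; reading the empty product as a
  unit makes it uniform, so that inductions need no extra base case.\<close>

lemma alt_prod_Suc:
  assumes "X \<in> Ob C" "R \<in> rels C X"
  shows "alt_prod C X R S (Suc n) = rel_comp C X R (alt_prod C X S R n)"
  using comp_diag[OF assms] by (cases n) simp_all

lemma alt_prod_reflexive: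
  assumes X: "X \<in> Ob C" and "R \<in> reflexive_rels C X" "S \<in> reflexive_rels C X"
  shows "alt_prod C X R S n \<in> reflexive_rels C X"
  using assms(2,3)
proof (induction n arbitrary: R S)
  case 0
  show ?case
    by (simp add: diag_reflexive[OF X])
next
  case (Suc n)
  show ?case
    unfolding alt_prod_Suc[OF X reflexive_relsD[OF Suc.prems(1)]]
    by (rule comp_reflexive[OF X Suc.IH[OF Suc.prems(2,1)] Suc.prems(1)])
qed

lemma alt_prod_le_Suc:
  assumes X: "X \<in> Ob C" and "R \<in> reflexive_rels C X" "S \<in> reflexive_rels C X"
  shows "sub_le C (alt_prod C X R S n) (alt_prod C X R S (Suc n))"
  using assms(2,3)
proof (induction n arbitrary: R S)
  case 0
  then show ?case
    by (simp add: reflexive_rels_def)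
next
  case (Suc n)
  note rels = alt_prod_reflexive[OF X Suc.prems(2,1), THEN reflexive_relsD]
  show ?case
    unfolding alt_prod_Suc[OF X reflexive_relsD[OF Suc.prems(1)]]
    by (rule comp_mono_right[OF X rels rels reflexive_relsD[OF Suc.prems(1)] Suc.IH[OF Suc.prems(2,1)]])
qed

lemma alt_prod_chain:
  assumes "X \<in> Ob C" "R \<in> reflexive_rels C X" "S \<in> reflexive_rels C X"
  shows "reflexive_chain C X (alt_prod C X R S)"
  unfolding reflexive_chain_def using alt_prod_reflexive[OF assms] alt_prod_le_Suc[OF assms] by blast

text \<open>A relation absorbing \<open>R\<close> and \<open>S\<close> on the left absorbs their alternating products. Here and
  below \<open>R\<close> and \<open>S\<close> are exchanged at each step of the induction.\<close>

lemma alt_prod_comp_le: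
  assumes X: "X \<in> Ob C" and A: "A \<in> rels C X"
    and "R \<in> reflexive_rels C X" "S \<in> reflexive_rels C X"
    and "sub_le C (rel_comp C X R A) A" "sub_le C (rel_comp C X S A) A"
  shows "sub_le C (rel_comp C X (alt_prod C X R S n) A) A"
  using assms(3-)
proof (induction n arbitrary: R S)
  case 0
  show ?case
    by (simp, rule comp_leI[OF X A diag_rels[OF X] A]) (simp add: related_diag_iff[OF X])
next
  case (Suc n)
  note rels = alt_prod_reflexive[OF X Suc.prems(2,1), THEN reflexive_relsD]
  show ?case
    unfolding alt_prod_Suc[OF X reflexive_relsD[OF Suc.prems(1)]]
    by (rule comp_comp_le[OF X reflexive_relsD[OF Suc.prems(1)] rels A A
          Suc.IH[OF Suc.prems(2,1,4,3)] Suc.prems(3)])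
qed

lemma alt_prod_le_preorder:
  assumes X: "X \<in> Ob C" and U: "U \<in> preorder_rels C X"
    and "R \<in> reflexive_rels C X" "S \<in> reflexive_rels C X" "sub_le C R U" "sub_le C S U"
  shows "sub_le C (alt_prod C X R S n) U"
  using assms(3-)
proof (induction n arbitrary: R S)
  case 0
  show ?case
    using preorder_relsD[OF U] by (simp add: reflexive_rels_def)
next
  case (Suc n)
  note U' = reflexive_relsD[OF preorder_relsD[OF U]]
  note R = reflexive_relsD[OF Suc.prems(1)]
  note rels = alt_prod_reflexive[OF X Suc.prems(2,1), THEN reflexive_relsD]
  show ?case
    unfolding alt_prod_Suc[OF X R]
  proof (rule comp_leI[OF X rels R U'])
    fix a b c
    assume "related C X (alt_prod C X S R n) a b" "related C X R b c"
    then have "related C X U a b" "related C X U b c"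
      using Suc.IH[OF Suc.prems(2,1,4,3)] Suc.prems(3)
      unfolding sub_le_iff[OF X rels U'] sub_le_iff[OF X R U'] by blast+
    then show "related C X U a c"
      using U unfolding preorder_rels_iff[OF X] by blast
  qed
qed

end

text \<open>An upper bound only has to bound those elements of \<open>A\<close> that lie in the carrier, whence the
  intersections.\<close>

lemma is_lub_incl_order_iff:
  "is_lub (incl_order C K) s A \<longleftrightarrow>
     s \<in> K \<and> (\<forall>x \<in> A \<inter> K. sub_le C x s) \<and>
     (\<forall>u \<in> K. (\<forall>x \<in> A \<inter> K. sub_le C x u) \<longrightarrow> sub_le C s u)"
  unfolding incl_order_def least_def Upper_def by auto

section \<open>Suprema of alternating products\<close>

locale stable_chain_category = regular_category +
  assumes ex_chain_sup: "X \<in> Ob C \<Longrightarrow> reflexive_chain C X R \<Longrightarrow>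
      \<exists>s. is_lub (incl_order C (reflexive_rels C X)) s (range R)"
    and chain_sup_comp: "X \<in> Ob C \<Longrightarrow> reflexive_chain C X R \<Longrightarrow> T \<in> reflexive_rels C X \<Longrightarrow>
      chain_sup C X (\<lambda>i. rel_comp C X (R i) T) = rel_comp C X (chain_sup C X R) T"
begin

lemma chain_sup_is_lub:
  assumes "X \<in> Ob C" "reflexive_chain C X R"
  shows "is_lub (incl_order C (reflexive_rels C X)) (chain_sup C X R) (range R)"
  unfolding chain_sup_def sup_def using ex_chain_sup[OF assms] by (rule someI_ex)

lemma chain_sup_reflexive:
  assumes "X \<in> Ob C" "reflexive_chain C X R"
  shows "chain_sup C X R \<in> reflexive_rels C X"
  using chain_sup_is_lub[OF assms] unfolding is_lub_incl_order_iff by blast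

lemma chain_sup_upper:
  assumes "X \<in> Ob C" "reflexive_chain C X R"
  shows "sub_le C (R i) (chain_sup C X R)"
proof -
  have "R i \<in> range R \<inter> reflexive_rels C X"
    using assms(2) unfolding reflexive_chain_def by blast
  then show ?thesis
    using chain_sup_is_lub[OF assms] unfolding is_lub_incl_order_iff by blast
qed

lemma chain_sup_least:
  assumes "X \<in> Ob C" "reflexive_chain C X R" "U \<in> reflexive_rels C X" "\<And>i. sub_le C (R i) U"
  shows "sub_le C (chain_sup C X R) U"
  using chain_sup_is_lub[OF assms(1,2)] assms(3,4) unfolding is_lub_incl_order_iff by blast

text \<open>The only form in which stability is used: an upper bound of the composites bounds the
  composite of the supremum.\<close>

lemma chain_sup_comp_le:
  assumes X: "X \<in> Ob C" and R: "reflexive_chain C X R"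
    and T: "T \<in> reflexive_rels C X" and U: "U \<in> reflexive_rels C X"
    and le: "\<And>i. sub_le C (rel_comp C X (R i) T) U"
  shows "sub_le C (rel_comp C X (chain_sup C X R) T) U"
proof -
  have refl: "R i \<in> reflexive_rels C X" and mono: "sub_le C (R i) (R (Suc i))" for i
    using R unfolding reflexive_chain_def by blast+
  note rels = reflexive_relsD[OF refl] and T' = reflexive_relsD[OF T]
  have "sub_le C (rel_comp C X (R i) T) (rel_comp C X (R (Suc i)) T)" for i
    using mono[of i] related_compI[OF X T' rels[of "Suc i"]] unfolding sub_le_iff[OF X rels rels]
    by (intro comp_leI[OF X T' rels comp_rels[OF X T' rels]]) blast
  then have "reflexive_chain C X (\<lambda>i. rel_comp C X (R i) T)"
    unfolding reflexive_chain_def using comp_reflexive[OF X T refl] by blast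
  then show ?thesis
    unfolding chain_sup_comp[OF X R T, symmetric] using U le by (rule chain_sup_least[OF X])
qed

text \<open>Stability with the chain as the right factor. Passing to opposites is an order automorphism of
  the reflexive relations, hence preserves suprema of chains, and it exchanges the two factors of a
  composite; so this is the previous lemma for the opposite chain.\<close>

lemma comp_chain_sup_le:
  assumes X: "X \<in> Ob C" and R: "reflexive_chain C X R"
    and T: "T \<in> reflexive_rels C X" and U: "U \<in> reflexive_rels C X"
    and le: "\<And>i. sub_le C (rel_comp C X T (R i)) U"
  shows "sub_le C (rel_comp C X T (chain_sup C X R)) U"
proof -
  let ?op = "rel_op C X" and ?S = "chain_sup C X R"
  have refl: "R i \<in> reflexive_rels C X" and mono: "sub_le C (R i) (R (Suc i))" for i
    using R unfolding reflexive_chain_def by blast+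
  note rels = reflexive_relsD[OF refl]
  note T' = reflexive_relsD[OF T] and U' = reflexive_relsD[OF U]
  note Tr = op_reflexive[OF X T] and Ur = op_reflexive[OF X U]
  note S' = reflexive_relsD[OF chain_sup_reflexive[OF X R]]
  note op = op_rels[OF X] related_op_iff[OF X]
  have chain: "reflexive_chain C X (\<lambda>i. ?op (R i))"
    unfolding reflexive_chain_def
  proof (intro allI conjI)
    fix i
    show "?op (R i) \<in> reflexive_rels C X"
      by (rule op_reflexive[OF X refl])
    show "sub_le C (?op (R i)) (?op (R (Suc i)))"
      using mono[of i] unfolding sub_le_iff[OF X rels rels] sub_le_iff[OF X op(1)[OF rels] op(1)[OF rels]]
        op(2)[OF rels] by blast
  qed
  let ?S' = "chain_sup C X (\<lambda>i. ?op (R i))"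
  note Sr' = chain_sup_reflexive[OF X chain] and S'' = reflexive_relsD[OF chain_sup_reflexive[OF X chain]]
  have "sub_le C (R i) (?op ?S')" for i
    using chain_sup_upper[OF X chain, of i]
    unfolding sub_le_iff[OF X rels op(1)[OF S'']] sub_le_iff[OF X op(1)[OF rels] S'']
      op(2)[OF rels] op(2)[OF S''] by blast
  then have SS': "sub_le C ?S (?op ?S')"
    by (rule chain_sup_least[OF X R op_reflexive[OF X Sr']])
  have "sub_le C (rel_comp C X (?op (R i)) (?op T)) (?op U)" for i
  proof (rule comp_leI[OF X op(1)[OF T'] op(1)[OF rels] op(1)[OF U']])
    fix a b c
    assume "related C X (?op T) a b" "related C X (?op (R i)) b c"
    then have "related C X (rel_comp C X T (R i)) c a"
      unfolding op(2)[OF T'] op(2)[OF rels] by (intro related_compI[OF X rels T'])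
    then show "related C X (?op U) a c"
      using le[of i] unfolding op(2)[OF U'] sub_le_iff[OF X comp_rels[OF X rels T'] U'] by blast
  qed
  then have le': "sub_le C (rel_comp C X ?S' (?op T)) (?op U)"
    by (rule chain_sup_comp_le[OF X chain Tr Ur])
  show ?thesis
  proof (rule comp_leI[OF X S' T' U'])
    fix a b c
    assume "related C X ?S a b" "related C X T b c"
    then have "related C X (?op T) c b" "related C X ?S' b a"
      using SS' unfolding sub_le_iff[OF X S' op(1)[OF S'']] op(2)[OF S''] op(2)[OF T'] by blast+
    then have "related C X (rel_comp C X ?S' (?op T)) c a"
      by (rule related_compI[OF X op(1)[OF T'] S''])
    then show "related C X U a c"
      using le' unfolding sub_le_iff[OF X comp_rels[OF X op(1)[OF T'] S''] op(1)[OF U']] op(2)[OF U']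
      by blast
  qed
qed

lemma alt_sup_reflexive:
  assumes "X \<in> Ob C" "R \<in> reflexive_rels C X" "S \<in> reflexive_rels C X"
  shows "alt_sup C X R S \<in> reflexive_rels C X"
  unfolding alt_sup_def by (rule chain_sup_reflexive[OF assms(1) alt_prod_chain[OF assms]])

text \<open>The chain \<open>((S, R))\<close> is interleaved with \<open>((R, S))\<close>: multiplying \<open>(S, R)\<^sub>n\<close> by the reflexive
  relation \<open>R\<close> enlarges it to \<open>(R, S)\<^sub>n\<^sub>+\<^sub>1\<close>.\<close>

lemma alt_prod_le_alt_sup:
  assumes X: "X \<in> Ob C" and R: "R \<in> reflexive_rels C X" and S: "S \<in> reflexive_rels C X"
  shows "sub_le C (alt_prod C X R S n) (alt_sup C X R S)"
    and "sub_le C (alt_prod C X S R n) (alt_sup C X R S)"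
proof -
  show 1: "sub_le C (alt_prod C X R S n) (alt_sup C X R S)" for n
    unfolding alt_sup_def by (rule chain_sup_upper[OF X alt_prod_chain[OF X R S]])
  note rels = reflexive_relsD[OF alt_prod_reflexive[OF X S R]]
  have "sub_le C (alt_prod C X S R n) (alt_prod C X R S (Suc n))"
    unfolding alt_prod_Suc[OF X reflexive_relsD[OF R]] by (rule le_comp_left[OF X R rels])
  then show "sub_le C (alt_prod C X S R n) (alt_sup C X R S)"
    by (rule rel_le_trans[OF X rels reflexive_relsD[OF alt_prod_reflexive[OF X R S]]
          reflexive_relsD[OF alt_sup_reflexive[OF X R S]] _ 1])
qed

lemma le_alt_sup:
  assumes "X \<in> Ob C" "R \<in> reflexive_rels C X" "S \<in> reflexive_rels C X"
  shows "sub_le C R (alt_sup C X R S)" "sub_le C S (alt_sup C X R S)"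
  using alt_prod_le_alt_sup[OF assms, of 1] by simp_all

text \<open>Write \<open>A\<close> for the supremum. Left multiplication by \<open>R\<close> or \<open>S\<close> moves the chain at most two
  steps up, so stability in the right factor gives \<open>R A \<subseteq> A\<close> and \<open>S A \<subseteq> A\<close>. Hence \<open>(R, S)\<^sub>n A \<subseteq> A\<close> for
  all \<open>n\<close>, and stability in the left factor gives \<open>A A \<subseteq> A\<close>.\<close>

lemma alt_sup_preorder:
  assumes X: "X \<in> Ob C" and R: "R \<in> preorder_rels C X" and S: "S \<in> preorder_rels C X"
  shows "alt_sup C X R S \<in> preorder_rels C X"
proof -
  let ?A = "alt_sup C X R S"
  note Rr = preorder_relsD[OF R] and Sr = preorder_relsD[OF S]
  note Ar = alt_sup_reflexive[OF X Rr Sr] and R' = reflexive_relsD[OF Rr] and S' = reflexive_relsD[OF Sr]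
  note A' = reflexive_relsD[OF Ar]
  note chain = alt_prod_chain[OF X Rr Sr]
  note rels = reflexive_relsD[OF alt_prod_reflexive[OF X Rr Sr]]
    and rels' = reflexive_relsD[OF alt_prod_reflexive[OF X Sr Rr]]
  note le = alt_prod_le_alt_sup[OF X Rr Sr]
  have RA: "sub_le C (rel_comp C X R ?A) ?A"
  proof (subst alt_sup_def, rule comp_chain_sup_le[OF X chain Rr Ar])
    fix n
    have "sub_le C (rel_comp C X R (alt_prod C X R S n)) (rel_comp C X R (alt_prod C X R S (Suc n)))"
      by (rule comp_mono_right[OF X rels rels R' alt_prod_le_Suc[OF X Rr Sr]])
    moreover have "sub_le C (rel_comp C X R (alt_prod C X R S (Suc n))) (alt_prod C X R S (Suc n))"
      unfolding alt_prod_Suc[OF X R'] by (rule preorder_comp_absorb[OF X R rels'])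
    ultimately have "sub_le C (rel_comp C X R (alt_prod C X R S n)) (alt_prod C X R S (Suc n))"
      by (rule rel_le_trans[OF X comp_rels[OF X rels R'] comp_rels[OF X rels R'] rels])
    then show "sub_le C (rel_comp C X R (alt_prod C X R S n)) ?A"
      by (rule rel_le_trans[OF X comp_rels[OF X rels R'] rels A' _ le(1)])
  qed
  have SA: "sub_le C (rel_comp C X S ?A) ?A"
  proof (subst alt_sup_def, rule comp_chain_sup_le[OF X chain Sr Ar])
    fix n
    show "sub_le C (rel_comp C X S (alt_prod C X R S n)) ?A"
      using le(2)[of "Suc n"] unfolding alt_prod_Suc[OF X S'] .
  qed
  have "sub_le C (rel_comp C X ?A ?A) ?A"
  proof (subst (1) alt_sup_def, rule chain_sup_comp_le[OF X chain Ar Ar])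
    fix n
    show "sub_le C (rel_comp C X (alt_prod C X R S n) ?A) ?A"
      by (rule alt_prod_comp_le[OF X A' Rr Sr RA SA])
  qed
  then show ?thesis
    unfolding preorder_rels_def using Ar by blast
qed

lemma alt_sup_least:
  assumes X: "X \<in> Ob C" and R: "R \<in> reflexive_rels C X" and S: "S \<in> reflexive_rels C X"
    and U: "U \<in> preorder_rels C X" "sub_le C R U" "sub_le C S U"
  shows "sub_le C (alt_sup C X R S) U"
  unfolding alt_sup_def
  by (rule chain_sup_least[OF X alt_prod_chain[OF X R S] preorder_relsD[OF U(1)]
        alt_prod_le_preorder[OF X U(1) R S U(2,3)]])

text \<open>The converse of an alternating product of symmetric relations is the product of the same
  factors in reverse order, hence is contained in every preorder above both.\<close>

lemma alt_prod_converse_le: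
  assumes X: "X \<in> Ob C" and A: "A \<in> preorder_rels C X"
    and "R \<in> equivalence_rels C X" "S \<in> equivalence_rels C X" "sub_le C R A" "sub_le C S A"
    and "related C X (alt_prod C X R S n) a b"
  shows "related C X A b a"
  using assms(3-)
proof (induction n arbitrary: R S a b)
  case 0
  then show ?case
    using preorder_relsD[OF A] by (simp add: related_diag_iff[OF X] reflexive_rels_iff[OF X])
next
  case (Suc n)
  note Rr = preorder_relsD[OF equivalence_relsD[OF Suc.prems(1)]]
    and Sr = preorder_relsD[OF equivalence_relsD[OF Suc.prems(2)]]
  note R' = reflexive_relsD[OF Rr] and rels = reflexive_relsD[OF alt_prod_reflexive[OF X Sr Rr]]
  note A' = reflexive_relsD[OF preorder_relsD[OF A]]
  obtain e d where e: "parallel C X a b" "regular_epi C e" "Cod C e = Dom C a"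
    and d: "related C X (alt_prod C X S R n) (a \<cdot> e) d" "related C X R d (b \<cdot> e)"
    using Suc.prems(5) unfolding alt_prod_Suc[OF X R'] by (rule related_compE[OF X rels R'])
  have "related C X R (b \<cdot> e) d"
    using Suc.prems(1) d(2) unfolding equivalence_rels_iff[OF X] by blast
  then have "related C X A (b \<cdot> e) d"
    using Suc.prems(3) unfolding sub_le_iff[OF X R' A'] by blast
  moreover have "related C X A d (a \<cdot> e)"
    by (rule Suc.IH[OF Suc.prems(2,1,4,3) d(1)])
  ultimately have "related C X A (b \<cdot> e) (a \<cdot> e)"
    using A unfolding preorder_rels_iff[OF X] by blast
  then show ?case
    by (rule related_descent[OF X A' e(2), rotated 2]) (use parallelD[OF e(1)] e(3) in \<open>simp_all add: parallel_def\<close>)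
qed

lemma alt_sup_equivalence:
  assumes X: "X \<in> Ob C" and R: "R \<in> equivalence_rels C X" and S: "S \<in> equivalence_rels C X"
  shows "alt_sup C X R S \<in> equivalence_rels C X"
proof -
  let ?A = "alt_sup C X R S"
  note Rr = preorder_relsD[OF equivalence_relsD[OF R]] and Sr = preorder_relsD[OF equivalence_relsD[OF S]]
  have A: "?A \<in> preorder_rels C X"
    by (rule alt_sup_preorder[OF X equivalence_relsD[OF R] equivalence_relsD[OF S]])
  note Ar = preorder_relsD[OF A] and A' = reflexive_relsD[OF preorder_relsD[OF A]]
  have "sub_le C (alt_prod C X R S n) (rel_op C X ?A)" for n
    unfolding sub_le_iff[OF X reflexive_relsD[OF alt_prod_reflexive[OF X Rr Sr]] op_rels[OF X A']]
      related_op_iff[OF X A']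
    using alt_prod_converse_le[OF X A R S le_alt_sup[OF X Rr Sr]] by blast
  then have "sub_le C ?A (rel_op C X ?A)"
    using chain_sup_least[OF X alt_prod_chain[OF X Rr Sr] op_reflexive[OF X Ar]]
    unfolding alt_sup_def by blast
  then show ?thesis
    unfolding equivalence_rels_iff[OF X] sub_le_iff[OF X A' op_rels[OF X A']] related_op_iff[OF X A']
    using A by blast
qed

lemma alt_sup_is_lub_preorder:
  assumes X: "X \<in> Ob C" and R: "R \<in> preorder_rels C X" and S: "S \<in> preorder_rels C X"
  shows "is_lub (incl_order C (preorder_rels C X)) (alt_sup C X R S) {R, S}"
proof -
  note Rr = preorder_relsD[OF R] and Sr = preorder_relsD[OF S]
  show ?thesis
    unfolding is_lub_incl_order_iff
    using alt_sup_preorder[OF X R S] le_alt_sup[OF X Rr Sr] alt_sup_least[OF X Rr Sr] R S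
    by blast
qed

lemma alt_sup_is_lub_equivalence:
  assumes X: "X \<in> Ob C" and R: "R \<in> equivalence_rels C X" and S: "S \<in> equivalence_rels C X"
  shows "is_lub (incl_order C (equivalence_rels C X)) (alt_sup C X R S) {R, S}"
proof -
  note Rr = preorder_relsD[OF equivalence_relsD[OF R]] and Sr = preorder_relsD[OF equivalence_relsD[OF S]]
  show ?thesis
    unfolding is_lub_incl_order_iff
    using alt_sup_equivalence[OF X R S] le_alt_sup[OF X Rr Sr]
      alt_sup_least[OF X Rr Sr equivalence_relsD] R S
    by blast
qed

end

section \<open>Inverse and direct images of preorders\<close>

context regular_category
begin

lemma parallel_comp_left:
  assumes "f \<in> Arr C" "Dom C f = X" "Cod C f = Y" "parallel C X a b"
  shows "parallel C Y (f \<cdot> a) (f \<cdot> b)"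
  using parallelD[OF assms(4)] assms(1-3) unfolding parallel_def by simp

lemma inv_img_reflexive:
  assumes f: "f \<in> Arr C" "Dom C f = X" "Cod C f = Y" and S: "S \<in> reflexive_rels C Y"
  shows "inv_img C f S \<in> reflexive_rels C X"
proof -
  have X: "X \<in> Ob C" and Y: "Y \<in> Ob C"
    using f Dom_Ob[of f] Cod_Ob[of f] by simp_all
  note S' = reflexive_relsD[OF S]
  have "related C X (inv_img C f S) a a" if "a \<in> Arr C" "Cod C a = X" for a
    using that f S unfolding related_inv_img_iff[OF f S'] reflexive_rels_iff[OF Y] parallel_def by simp
  then show ?thesis
    unfolding reflexive_rels_iff[OF X] using inv_img_rels[OF f S'] by blast
qed

lemma inv_img_preorder:
  assumes f: "f \<in> Arr C" "Dom C f = X" "Cod C f = Y" and S: "S \<in> preorder_rels C Y"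
  shows "inv_img C f S \<in> preorder_rels C X"
proof -
  have X: "X \<in> Ob C" and Y: "Y \<in> Ob C"
    using f Dom_Ob[of f] Cod_Ob[of f] by simp_all
  note Sr = preorder_relsD[OF S]
  have par: "parallel C X a c" if "parallel C X a b" "parallel C X b c" for a b c
    using that unfolding parallel_def by simp
  have "related C Y S a c" if "related C Y S a b" "related C Y S b c" for a b c
    using S that unfolding preorder_rels_iff[OF Y] by blast
  then show ?thesis
    using inv_img_reflexive[OF f Sr] par
    unfolding preorder_rels_iff[OF X] related_inv_img_iff[OF f reflexive_relsD[OF Sr]] by blast
qed

lemma inv_img_equivalence:
  assumes f: "f \<in> Arr C" "Dom C f = X" "Cod C f = Y" and S: "S \<in> equivalence_rels C Y"
  shows "inv_img C f S \<in> equivalence_rels C X"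
proof -
  have X: "X \<in> Ob C" and Y: "Y \<in> Ob C"
    using f Dom_Ob[of f] Cod_Ob[of f] by simp_all
  note Sp = equivalence_relsD[OF S]
  have par: "parallel C X b a" if "parallel C X a b" for a b
    using that unfolding parallel_def by simp
  have "related C Y S b a" if "related C Y S a b" for a b
    using S that unfolding equivalence_rels_iff[OF Y] by blast
  then show ?thesis
    using inv_img_preorder[OF f Sp] par
    unfolding equivalence_rels_iff[OF X]
      related_inv_img_iff[OF f reflexive_relsD[OF preorder_relsD[OF Sp]]] by blast
qed

lemma diag_equivalence:
  assumes X: "X \<in> Ob C"
  shows "diag C X \<in> equivalence_rels C X"
  using diag_reflexive[OF X]
  unfolding equivalence_rels_iff[OF X] preorder_rels_iff[OF X] related_diag_iff[OF X] by blast

lemma ker_rel_equivalence: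
  assumes f: "f \<in> Arr C" "Dom C f = X" "Cod C f = Y"
  shows "ker_rel C f \<in> equivalence_rels C X"
proof -
  have "Y \<in> Ob C"
    using f Cod_Ob[of f] by simp
  then show ?thesis
    unfolding ker_rel_def f(3) by (intro inv_img_equivalence[OF f] diag_equivalence)
qed

lemma related_ker_rel_iff:
  assumes f: "f \<in> Arr C" "Dom C f = X" "Cod C f = Y"
  shows "related C X (ker_rel C f) a b \<longleftrightarrow> parallel C X a b \<and> f \<cdot> a = f \<cdot> b"
proof -
  have Y: "Y \<in> Ob C"
    using f Cod_Ob[of f] by simp
  show ?thesis
    unfolding ker_rel_def f(3) related_inv_img_iff[OF f diag_rels[OF Y]] related_diag_iff[OF Y]
    using f by (auto simp: parallel_def)
qed

lemma ker_rel_le_inv_img: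
  assumes f: "f \<in> Arr C" "Dom C f = X" "Cod C f = Y" and S: "S \<in> reflexive_rels C Y"
  shows "sub_le C (ker_rel C f) (inv_img C f S)"
proof -
  have X: "X \<in> Ob C" and Y: "Y \<in> Ob C"
    using f Dom_Ob[of f] Cod_Ob[of f] by simp_all
  note S' = reflexive_relsD[OF S]
  have ker: "ker_rel C f \<in> rels C X"
    using ker_rel_equivalence[OF f] equivalence_relsD preorder_relsD reflexive_relsD by blast
  show ?thesis
    unfolding sub_le_iff[OF X ker inv_img_rels[OF f S']]
  proof (intro allI impI)
    fix a b
    assume "related C X (ker_rel C f) a b"
    then have ab: "parallel C X a b" "f \<cdot> a = f \<cdot> b"
      unfolding related_ker_rel_iff[OF f] by blast+
    have "related C Y S (f \<cdot> a) (f \<cdot> a)"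
      using S parallelD[OF parallel_comp_left[OF f ab(1)]] unfolding reflexive_rels_iff[OF Y] by blast
    then show "related C X (inv_img C f S) a b"
      unfolding related_inv_img_iff[OF f S'] using ab by metis
  qed
qed

lemma le_inv_img_dir_img:
  assumes f: "f \<in> Arr C" "Dom C f = X" "Cod C f = Y" and R: "R \<in> rels C X"
  shows "sub_le C R (inv_img C f (dir_img C f R))"
proof -
  have X: "X \<in> Ob C"
    using f Dom_Ob[of f] by simp
  note D = dir_img_rels[OF f R]
  show ?thesis
    unfolding sub_le_iff[OF X R inv_img_rels[OF f D]]
  proof (intro allI impI)
    fix a b
    assume ab: "related C X R a b"
    have par: "parallel C X a b"
      by (rule related_parallel[OF X R ab])
    note par' = parallel_comp_left[OF f par]
    have id: "regular_epi C (Ident C (Dom C (f \<cdot> a)))" "Cod C (Ident C (Dom C (f \<cdot> a))) = Dom C (f \<cdot> a)"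
      "f \<cdot> a = (f \<cdot> a) \<cdot> Ident C (Dom C (f \<cdot> a))" "f \<cdot> b = (f \<cdot> b) \<cdot> Ident C (Dom C (f \<cdot> a))"
      using parallelD[OF par] f by (simp_all add: regular_epi_Ident)
    then have "related C Y (dir_img C f R) (f \<cdot> a) (f \<cdot> b)"
      unfolding related_dir_img_iff[OF f R] using par' ab by blast
    then show "related C X (inv_img C f (dir_img C f R)) a b"
      unfolding related_inv_img_iff[OF f D] using par by blast
  qed
qed

text \<open>With the preceding lemma: direct image is left adjoint to inverse image.\<close>

lemma dir_img_least:
  assumes f: "f \<in> Arr C" "Dom C f = X" "Cod C f = Y" and R: "R \<in> rels C X" and S: "S \<in> rels C Y"
    and le: "sub_le C R (inv_img C f S)"
  shows "sub_le C (dir_img C f R) S"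
proof -
  have X: "X \<in> Ob C" and Y: "Y \<in> Ob C"
    using f Dom_Ob[of f] Cod_Ob[of f] by simp_all
  show ?thesis
    unfolding sub_le_iff[OF Y dir_img_rels[OF f R] S]
  proof (intro allI impI)
    fix a b
    assume "related C Y (dir_img C f R) a b"
    then obtain e x y where e: "parallel C Y a b" "regular_epi C e" "Cod C e = Dom C a"
      and xy: "related C X R x y" "f \<cdot> x = a \<cdot> e" "f \<cdot> y = b \<cdot> e"
      unfolding related_dir_img_iff[OF f R] by blast
    have "related C Y S (f \<cdot> x) (f \<cdot> y)"
      using le xy(1) unfolding sub_le_iff[OF X R inv_img_rels[OF f S]] related_inv_img_iff[OF f S]
      by blast
    then show "related C Y S a b"
      unfolding xy(2,3) by (rule related_descent[OF Y S e(2,1,3)])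
  qed
qed

text \<open>Every element of \<open>Y\<close> lifts locally along the regular epimorphism \<open>f\<close>.\<close>

lemma dir_img_reflexive:
  assumes f: "f \<in> Arr C" "Dom C f = X" "Cod C f = Y" "regular_epi C f" and R: "R \<in> reflexive_rels C X"
  shows "dir_img C f R \<in> reflexive_rels C Y"
proof -
  have X: "X \<in> Ob C" and Y: "Y \<in> Ob C"
    using f Dom_Ob[of f] Cod_Ob[of f] by simp_all
  note R' = reflexive_relsD[OF R]
  have "related C Y (dir_img C f R) a a" if a: "a \<in> Arr C" "Cod C a = Y" for a
  proof -
    obtain x q where pb: "is_pullback C f a x q"
      using ex_pullback[of f a] a f by auto
    have "related C X R x x"
      using R pullbackD(3,7)[OF pb] f(2) unfolding reflexive_rels_iff[OF X] by simp
    moreover have "parallel C Y a a"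
      unfolding parallel_def using a by simp
    ultimately show ?thesis
      unfolding related_dir_img_iff[OF f(1-3) R']
      using regular_epi_stable[OF pb f(4)] pullbackD(8,9)[OF pb] by blast
  qed
  then show ?thesis
    unfolding reflexive_rels_iff[OF Y] using dir_img_rels[OF f(1-3) R'] by blast
qed

text \<open>Direct images of transitive relations need not be transitive: the two witnesses
  \<open>x R y\<close> and \<open>y' R z\<close> for a composable pair only satisfy \<open>f y = f y'\<close>. As \<open>R\<close> contains the kernel
  relation of \<open>f\<close>, also \<open>y R y'\<close>, and therefore \<open>x R z\<close>.\<close>

lemma dir_img_preorder:
  assumes f: "f \<in> Arr C" "Dom C f = X" "Cod C f = Y" "regular_epi C f" and R: "R \<in> preorder_rels C X"
    and ker: "sub_le C (ker_rel C f) R"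
  shows "dir_img C f R \<in> preorder_rels C Y"
proof -
  have X: "X \<in> Ob C" and Y: "Y \<in> Ob C"
    using f Dom_Ob[of f] Cod_Ob[of f] by simp_all
  note Rr = preorder_relsD[OF R]
  note R' = reflexive_relsD[OF Rr]
  note D = dir_img_rels[OF f(1-3) R'] and rel = related_dir_img_iff[OF f(1-3) R']
  have ker': "ker_rel C f \<in> rels C X"
    using ker_rel_equivalence[OF f(1-3)] equivalence_relsD preorder_relsD reflexive_relsD by blast
  have "related C Y (dir_img C f R) a c"
    if ab: "related C Y (dir_img C f R) a b" and bc: "related C Y (dir_img C f R) b c" for a b c
  proof -
    obtain e x y where e: "parallel C Y a b" "regular_epi C e" "Cod C e = Dom C a"
      and xy: "related C X R x y" "f \<cdot> x = a \<cdot> e" "f \<cdot> y = b \<cdot> e"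
      using ab unfolding rel by blast
    note parab [simp] = parallelD[OF e(1)] and parbc = parallelD[OF related_parallel[OF Y D bc]]
    note [simp] = e(3) regular_epi_Arr[OF e(2)] f(1-3) parbc(2,5)
    have [simp]: "Dom C c = Dom C a"
      using parbc(3) by simp
    note parxy = parallelD[OF related_parallel[OF X R' xy(1)]]
    note [simp] = parxy
    have "Dom C (f \<cdot> x) = Dom C (a \<cdot> e)"
      unfolding xy(2) ..
    then have [simp]: "Dom C x = Dom C e"
      by simp
    have bc': "related C Y (dir_img C f R) (b \<cdot> e) (c \<cdot> e)"
      by (rule related_comp[OF Y D bc]) simp_all
    obtain d y' z where d: "parallel C Y (b \<cdot> e) (c \<cdot> e)" "regular_epi C d" "Cod C d = Dom C (b \<cdot> e)"
      and yz: "related C X R y' z" "f \<cdot> y' = (b \<cdot> e) \<cdot> d" "f \<cdot> z = (c \<cdot> e) \<cdot> d"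
      using bc' unfolding rel by blast
    note [simp] = regular_epi_Arr[OF d(2)] parallelD[OF related_parallel[OF X R' yz(1)]]
    have [simp]: "Cod C d = Dom C e"
      using d(3) by simp
    have "Dom C (f \<cdot> y') = Dom C ((b \<cdot> e) \<cdot> d)"
      unfolding yz(2) ..
    then have [simp]: "Dom C y' = Dom C d"
      by simp
    have xd: "f \<cdot> (x \<cdot> d) = (a \<cdot> e) \<cdot> d" and yd: "f \<cdot> (y \<cdot> d) = (b \<cdot> e) \<cdot> d"
      by (rule Comp_eq_extend_single; simp add: xy)+
    have "related C X (ker_rel C f) (y \<cdot> d) y'"
      unfolding related_ker_rel_iff[OF f(1-3)] yd yz(2) parallel_def by simp
    then have "related C X R (y \<cdot> d) y'"
      using ker unfolding sub_le_iff[OF X ker' R'] by blast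
    moreover have "related C X R (x \<cdot> d) (y \<cdot> d)"
      by (rule related_comp[OF X R' xy(1)]) simp_all
    ultimately have xz: "related C X R (x \<cdot> d) z"
      using R yz(1) unfolding preorder_rels_iff[OF X] by blast
    have "related C Y (dir_img C f R) (a \<cdot> e) (c \<cdot> e)"
      unfolding rel
    proof (intro conjI exI)
      show "parallel C Y (a \<cdot> e) (c \<cdot> e)"
        unfolding parallel_def by simp
      show "Cod C d = Dom C (a \<cdot> e)"
        by simp
    qed (rule d(2) xz xd yz(3))+
    then show ?thesis
      by (rule related_descent[OF Y D e(2), rotated 2]) (simp_all add: parallel_def)
  qed
  then show ?thesis
    unfolding preorder_rels_iff[OF Y] using dir_img_reflexive[OF f Rr] by blast
qed

lemma dir_img_equivalence:
  assumes f: "f \<in> Arr C" "Dom C f = X" "Cod C f = Y" "regular_epi C f" and R: "R \<in> equivalence_rels C X"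
    and ker: "sub_le C (ker_rel C f) R"
  shows "dir_img C f R \<in> equivalence_rels C Y"
proof -
  have X: "X \<in> Ob C" and Y: "Y \<in> Ob C"
    using f Dom_Ob[of f] Cod_Ob[of f] by simp_all
  note Rp = equivalence_relsD[OF R]
  note rel = related_dir_img_iff[OF f(1-3) reflexive_relsD[OF preorder_relsD[OF Rp]]]
  have sym: "related C X R y x" if "related C X R x y" for x y
    using R that unfolding equivalence_rels_iff[OF X] by blast
  have "related C Y (dir_img C f R) b a" if "related C Y (dir_img C f R) a b" for a b
  proof -
    obtain e x y where e: "parallel C Y a b" "regular_epi C e" "Cod C e = Dom C a"
      and xy: "related C X R x y" "f \<cdot> x = a \<cdot> e" "f \<cdot> y = b \<cdot> e"
      using \<open>related C Y (dir_img C f R) a b\<close> unfolding rel by blast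
    have "parallel C Y b a" "Cod C e = Dom C b"
      using parallelD[OF e(1)] e(3) unfolding parallel_def by simp_all
    then show ?thesis
      unfolding rel using e(2) sym[OF xy(1)] xy(2,3) by blast
  qed
  then show ?thesis
    unfolding equivalence_rels_iff[OF Y] using dir_img_preorder[OF f Rp ker] by blast
qed

end

section \<open>Cocartesian maps\<close>

context regular_category
begin

lemma le_inv_img_Ident:
  assumes X: "X \<in> Ob C" and R: "R \<in> rels C X" "S \<in> rels C X" and le: "sub_le C R S"
  shows "sub_le C R (inv_img C (Ident C X) S)"
proof -
  have id: "Ident C X \<in> Arr C" "Dom C (Ident C X) = X" "Cod C (Ident C X) = X"
    using X by simp_all
  have "related C X (inv_img C (Ident C X) S) a b" if "related C X R a b" for a b
  proof -
    have par: "parallel C X a b"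
      by (rule related_parallel[OF X R(1) that])
    then have "Ident C X \<cdot> a = a" "Ident C X \<cdot> b = b"
      using parallelD[OF par] by simp_all
    then show ?thesis
      unfolding related_inv_img_iff[OF id R(2)] using par le that unfolding sub_le_iff[OF X R] by simp
  qed
  then show ?thesis
    unfolding sub_le_iff[OF X R(1) inv_img_rels[OF id R(2)]] by blast
qed

lemma Arr_full_Ref_iff:
  "((X, R), f, (Y, S)) \<in> Arr (full_subcat (Ref_cat C) {(Z, T). T \<in> K Z}) \<longleftrightarrow>
    X \<in> Ob C \<and> R \<in> reflexive_rels C X \<and> Y \<in> Ob C \<and> S \<in> reflexive_rels C Y \<and>
    f \<in> hom_set C X Y \<and> sub_le C R (inv_img C f S) \<and> R \<in> K X \<and> S \<in> K Y"
  unfolding full_subcat_def Ref_cat_def by auto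

text \<open>The argument for preorders and for equivalence relations depends only on a class \<open>K\<close> of
  reflexive relations that has the join of \<open>T\<close> with the kernel relation, contains the direct image of
  this join, and is closed under inverse images along \<open>f\<close>.\<close>

lemma cocartesian_of_join:
  fixes K :: "'a \<Rightarrow> 'b set set"
  defines "D \<equiv> full_subcat (Ref_cat C) {(Z, T). T \<in> K Z}"
  assumes f: "f \<in> hom_set C X Y"
    and K: "\<And>Z. K Z \<subseteq> reflexive_rels C Z"
    and Q: "is_lub (incl_order C (K X)) Q {ker_rel C f, T}" "ker_rel C f \<in> K X" "T \<in> K X"
    and dir: "dir_img C f Q \<in> K Y"
    and inv: "\<And>S. S \<in> K Y \<Longrightarrow> inv_img C f S \<in> K X"
    and i: "i = ((X, T), Ident C X, (X, Q))"
    and q: "q = ((X, Q), f, (Y, dir_img C f Q))"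
  shows "i \<in> Arr D" "q \<in> Arr D" "Dom D (q \<cdot>\<^bsub>D\<^esub> i) = (X, T)" "ground_arr (q \<cdot>\<^bsub>D\<^esub> i) = f"
    "cocartesian D C ground_ob ground_arr (q \<cdot>\<^bsub>D\<^esub> i)"
proof -
  have f' [simp]: "f \<in> Arr C" "Dom C f = X" "Cod C f = Y"
    using f unfolding hom_set_def by simp_all
  have X [simp]: "X \<in> Ob C" and Y [simp]: "Y \<in> Ob C"
    using f' Dom_Ob[of f] Cod_Ob[of f] by simp_all
  have QK: "Q \<in> K X" and TQ: "sub_le C T Q"
    and least: "\<And>U. U \<in> K X \<Longrightarrow> sub_le C (ker_rel C f) U \<Longrightarrow> sub_le C T U \<Longrightarrow> sub_le C Q U"
    using Q unfolding is_lub_incl_order_iff by blast+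
  note refl = subsetD[OF K]
  note rels = reflexive_relsD[OF refl]
  have idX: "Ident C X \<in> hom_set C X X" and idY: "Ident C Y \<in> hom_set C Y Y"
    unfolding hom_set_def by simp_all
  have Qf: "sub_le C Q (inv_img C f (dir_img C f Q))"
    by (rule le_inv_img_dir_img[OF f' rels[OF QK]])
  have Tf: "sub_le C T (inv_img C f (dir_img C f Q))"
    by (rule rel_le_trans[OF X rels[OF Q(3)] rels[OF QK] inv_img_rels[OF f' rels[OF dir]] TQ Qf])
  show "i \<in> Arr D"
    unfolding i D_def Arr_full_Ref_iff using refl Q(3) QK idX
      le_inv_img_Ident[OF X rels[OF Q(3)] rels[OF QK] TQ] by simp
  show "q \<in> Arr D"
    unfolding q D_def Arr_full_Ref_iff using refl dir QK f Qf by simp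
  have comp: "(B', g, E) \<cdot>\<^bsub>D\<^esub> (A, f, B) = (A, g \<cdot> f, E)" for A B B' E f g
    unfolding D_def full_subcat_def Ref_cat_def by simp
  have DomD: "Dom D (A, g, B) = A" and CodD: "Cod D (A, g, B) = B" for A g B
    unfolding D_def full_subcat_def Ref_cat_def by simp_all
  have h: "q \<cdot>\<^bsub>D\<^esub> i = ((X, T), f, (Y, dir_img C f Q))"
    unfolding i q comp by simp
  show "Dom D (q \<cdot>\<^bsub>D\<^esub> i) = (X, T)" "ground_arr (q \<cdot>\<^bsub>D\<^esub> i) = f"
    unfolding h DomD ground_arr_def by simp_all
  show "cocartesian D C ground_ob ground_arr (q \<cdot>\<^bsub>D\<^esub> i)"
    unfolding cocartesian_def h CodD DomD
  proof (intro conjI ballI impI)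
    show "((X, T), f, (Y, dir_img C f Q)) \<in> Arr D"
      unfolding D_def Arr_full_Ref_iff using refl dir Q(3) f Tf by simp
  next
    fix \<phi>
    assume phi: "\<phi> \<in> Arr D" "Dom D \<phi> = (X, T) \<and>
      ground_arr \<phi> = ground_arr ((X, T), f, (Y, dir_img C f Q))"
    obtain A g Y' S where phi_eq: "\<phi> = (A, g, (Y', S))"
      by (metis surj_pair)
    then have "A = (X, T)" "g = f"
      using phi(2) unfolding ground_arr_def phi_eq DomD by simp_all
    then have phi_eq: "\<phi> = ((X, T), f, (Y', S))"
      using phi_eq by simp
    have S: "f \<in> hom_set C X Y'" "sub_le C T (inv_img C f S)" "S \<in> K Y'"
      using phi(1) unfolding phi_eq D_def Arr_full_Ref_iff by blast+
    then have [simp]: "Y' = Y"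
      unfolding hom_set_def by simp
    have SK: "S \<in> K Y"
      using S(3) by simp
    \<comment> \<open>The inverse image of \<open>S\<close> contains the kernel relation because \<open>S\<close> is reflexive, hence it
      contains the join \<open>Q\<close>; now transpose along \<open>f\<close>.\<close>
    have "sub_le C Q (inv_img C f S)"
      by (rule least[OF inv[OF SK] ker_rel_le_inv_img[OF f' refl[OF SK]] S(2)])
    then have "sub_le C (dir_img C f Q) S"
      by (rule dir_img_least[OF f' rels[OF QK] rels[OF SK]])
    then have le: "sub_le C (dir_img C f Q) (inv_img C (Ident C Y) S)"
      by (rule le_inv_img_Ident[OF Y rels[OF dir] rels[OF SK]])
    show "\<exists>!\<psi>. \<psi> \<in> hom_set D (Y, dir_img C f Q) (Cod D \<phi>) \<and>
        \<psi> \<cdot>\<^bsub>D\<^esub> ((X, T), f, (Y, dir_img C f Q)) = \<phi> \<and>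
        ground_arr \<psi> = Ident C (ground_ob (Y, dir_img C f Q))"
    proof (rule ex1I[of _ "((Y, dir_img C f Q), Ident C Y, (Y, S))"])
      have "((Y, dir_img C f Q), Ident C Y, (Y, S)) \<in> Arr D"
        unfolding D_def Arr_full_Ref_iff using refl dir SK idY le by simp
      then show "((Y, dir_img C f Q), Ident C Y, (Y, S)) \<in> hom_set D (Y, dir_img C f Q) (Cod D \<phi>) \<and>
          ((Y, dir_img C f Q), Ident C Y, (Y, S)) \<cdot>\<^bsub>D\<^esub> ((X, T), f, (Y, dir_img C f Q)) = \<phi> \<and>
          ground_arr ((Y, dir_img C f Q), Ident C Y, (Y, S)) = Ident C (ground_ob (Y, dir_img C f Q))"
        unfolding phi_eq hom_set_def comp ground_arr_def ground_ob_def by (simp add: DomD CodD)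
    next
      fix \<psi>
      assume psi: "\<psi> \<in> hom_set D (Y, dir_img C f Q) (Cod D \<phi>) \<and>
        \<psi> \<cdot>\<^bsub>D\<^esub> ((X, T), f, (Y, dir_img C f Q)) = \<phi> \<and>
        ground_arr \<psi> = Ident C (ground_ob (Y, dir_img C f Q))"
      obtain A g B where psi_eq: "\<psi> = (A, g, B)"
        by (metis surj_pair)
      show "\<psi> = ((Y, dir_img C f Q), Ident C Y, (Y, S))"
        using psi unfolding psi_eq phi_eq hom_set_def ground_arr_def ground_ob_def by (simp add: DomD CodD)
    qed
  qed
qed

end

context stable_chain_category
begin

lemma preorder_cocartesian:
  assumes f: "f \<in> hom_set C X Y" and re: "regular_epi C f" and T: "T \<in> preorder_rels C X"
    and Q: "Q = alt_sup C X (ker_rel C f) T"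
    and i: "i = ((X, T), Ident C X, (X, Q))"
    and q: "q = ((X, Q), f, (Y, dir_img C f Q))"
  shows "i \<in> Arr (PrO_cat C) \<and> q \<in> Arr (PrO_cat C) \<and> Dom (PrO_cat C) (q \<cdot>\<^bsub>PrO_cat C\<^esub> i) = (X, T) \<and>
    ground_arr (q \<cdot>\<^bsub>PrO_cat C\<^esub> i) = f \<and>
    cocartesian (PrO_cat C) C ground_ob ground_arr (q \<cdot>\<^bsub>PrO_cat C\<^esub> i)"
proof -
  have f': "f \<in> Arr C" "Dom C f = X" "Cod C f = Y"
    using f unfolding hom_set_def by simp_all
  have X: "X \<in> Ob C"
    using f' Dom_Ob[of f] by simp
  have ker: "ker_rel C f \<in> preorder_rels C X"
    by (rule equivalence_relsD[OF ker_rel_equivalence[OF f']])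
  have lub: "is_lub (incl_order C (preorder_rels C X)) Q {ker_rel C f, T}"
    unfolding Q by (rule alt_sup_is_lub_preorder[OF X ker T])
  then have "Q \<in> preorder_rels C X" "sub_le C (ker_rel C f) Q"
    using ker unfolding is_lub_incl_order_iff by blast+
  then have dir: "dir_img C f Q \<in> preorder_rels C Y"
    by (rule dir_img_preorder[OF f' re])
  show ?thesis
    unfolding PrO_cat_def
    using cocartesian_of_join[OF f _ lub ker T dir inv_img_preorder[OF f'] i q]
    by (auto dest: preorder_relsD)
qed

lemma equivalence_cocartesian:
  assumes f: "f \<in> hom_set C X Y" and re: "regular_epi C f" and T: "T \<in> equivalence_rels C X"
    and Q: "Q = alt_sup C X (ker_rel C f) T"
    and i: "i = ((X, T), Ident C X, (X, Q))"
    and q: "q = ((X, Q), f, (Y, dir_img C f Q))"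
  shows "i \<in> Arr (Equ_cat C) \<and> q \<in> Arr (Equ_cat C) \<and> Dom (Equ_cat C) (q \<cdot>\<^bsub>Equ_cat C\<^esub> i) = (X, T) \<and>
    ground_arr (q \<cdot>\<^bsub>Equ_cat C\<^esub> i) = f \<and>
    cocartesian (Equ_cat C) C ground_ob ground_arr (q \<cdot>\<^bsub>Equ_cat C\<^esub> i)"
proof -
  have f': "f \<in> Arr C" "Dom C f = X" "Cod C f = Y"
    using f unfolding hom_set_def by simp_all
  have X: "X \<in> Ob C"
    using f' Dom_Ob[of f] by simp
  have ker: "ker_rel C f \<in> equivalence_rels C X"
    by (rule ker_rel_equivalence[OF f'])
  have lub: "is_lub (incl_order C (equivalence_rels C X)) Q {ker_rel C f, T}"
    unfolding Q by (rule alt_sup_is_lub_equivalence[OF X ker T])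
  then have "Q \<in> equivalence_rels C X" "sub_le C (ker_rel C f) Q"
    using ker unfolding is_lub_incl_order_iff by blast+
  then have dir: "dir_img C f Q \<in> equivalence_rels C Y"
    by (rule dir_img_equivalence[OF f' re])
  show ?thesis
    unfolding Equ_cat_def
    using cocartesian_of_join[OF f _ lub ker T dir inv_img_equivalence[OF f'] i q]
    by (auto dest: equivalence_relsD preorder_relsD)
qed

end

theorem corollary4p1:
  fixes E :: "('o, 'm) cat"
  assumes regular: "regular_category E"
    and chain_sups: "\<And>X R. X \<in> Ob E \<Longrightarrow> reflexive_chain E X R \<Longrightarrow>
      \<exists>s. is_lub (incl_order E (reflexive_rels E X)) s (range R)"
    and stable: "\<And>X R T. X \<in> Ob E \<Longrightarrow> reflexive_chain E X R \<Longrightarrow> T \<in> reflexive_rels E X \<Longrightarrow>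
      chain_sup E X (\<lambda>i. rel_comp E X (R i) T) = rel_comp E X (chain_sup E X R) T"
  shows
    "(\<forall>X \<in> Ob E. \<forall>R \<in> preorder_rels E X. \<forall>S \<in> preorder_rels E X.
        is_lub (incl_order E (preorder_rels E X)) (alt_sup E X R S) {R, S})
   \<and> (\<forall>X \<in> Ob E. \<forall>R \<in> equivalence_rels E X. \<forall>S \<in> equivalence_rels E X.
        is_lub (incl_order E (equivalence_rels E X)) (alt_sup E X R S) {R, S})
   \<and> (\<forall>X Y f T. f \<in> hom_set E X Y \<and> regular_epi E f \<and> T \<in> preorder_rels E X \<longrightarrow>
        (let Q = alt_sup E X (ker_rel E f) T;
             i = ((X, T), Ident E X, (X, Q));
             q = ((X, Q), f, (Y, dir_img E f Q));
             h = q \<cdot>\<^bsub>PrO_cat E\<^esub> i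
         in i \<in> Arr (PrO_cat E) \<and> q \<in> Arr (PrO_cat E) \<and>
            Dom (PrO_cat E) h = (X, T) \<and> ground_arr h = f \<and>
            cocartesian (PrO_cat E) E ground_ob ground_arr h))
   \<and> (\<forall>X Y f T. f \<in> hom_set E X Y \<and> regular_epi E f \<and> T \<in> equivalence_rels E X \<longrightarrow>
        (let Q = alt_sup E X (ker_rel E f) T;
             i = ((X, T), Ident E X, (X, Q));
             q = ((X, Q), f, (Y, dir_img E f Q));
             h = q \<cdot>\<^bsub>Equ_cat E\<^esub> i
         in i \<in> Arr (Equ_cat E) \<and> q \<in> Arr (Equ_cat E) \<and>
            Dom (Equ_cat E) h = (X, T) \<and> ground_arr h = f \<and>
            cocartesian (Equ_cat E) E ground_ob ground_arr h))"
proof -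
  interpret regular_category E
    by (rule regular)
  interpret stable_chain_category E
    using chain_sups stable by unfold_locales
  show ?thesis
    unfolding Let_def
    using alt_sup_is_lub_preorder alt_sup_is_lub_equivalence
      preorder_cocartesian[OF _ _ _ refl refl refl] equivalence_cocartesian[OF _ _ _ refl refl refl]
    by blast
qed

end
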